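(* Let $(X,\sigma)$ be a minimal subshift over a finite alphabet, with complexity function $P_X$, such that $$\limsup_{n\to\infty}\frac{P_X(n)}{n^{3}}=0.$$ Then every finitely generated, torsion free subgroup of $\mathrm{Aut}(X)$ is virtually abelian.
   Context: Let $\mathcal{A}$ be a finite set with the discrete topology, and give $\mathcal{A}^{\mathbb{Z}}$ the product topology. The left shift $\sigma\colon\mathcal{A}^{\mathbb{Z}}\to\mathcal{A}^{\mathbb{Z}}$ is $\sigma((x_i)_{i\in\mathbb{Z}})=(x_{i+1})_{i\in\mathbb{Z}}$. A subshift $(X,\sigma)$ is a closed, $\sigma$-invariant set $X\subset\mathcal{A}^{\mathbb{Z}}$ with the subspace topology and the restriction of $\sigma$. It is minimal if it is nonempty and the $\sigma$-orbit of every $x\in X$ is dense in $X$. The complexity function is $P_X(n)=$ the number of words $w=w_0\cdots w_{n-1}\in\mathcal{A}^n$ such that some $x\in X$ satisfies $x_i=w_i$ for all $0\le i<n$. $\mathrm{Aut}(X)$ is the group, under composition, of all homeomorphisms $\phi\colon X\to X$ with $\phi\circ\sigma=\sigma\circ\phi$. A group is virtually abelian if it has an abelian subgroup of finite index. *)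

theory Defs
  imports "HOL-Analysis.Analysis" "HOL-Algebra.Bij" "HOL-Algebra.Generated_Groups"
begin

text \<open>Frees the name for the topological closure operator.\<close>

no_notation eq_closure_of (\<open>closure'_of\<index>\<close>)

section \<open>Subshifts\<close>

definition shift :: "(int \<Rightarrow> 'a) \<Rightarrow> int \<Rightarrow> 'a"
  where "shift x = (\<lambda>i. x (i + 1))"

definition full_shift :: "'a set \<Rightarrow> (int \<Rightarrow> 'a) topology"
  where "full_shift A = product_topology (\<lambda>_. discrete_topology A) UNIV"

text \<open>
  Invariance is the equality \<open>shift ` X = X\<close>, so that the restriction of the
  shift to \<open>X\<close> is a homeomorphism of \<open>X\<close>.
\<close>

definition subshift :: "'a set \<Rightarrow> (int \<Rightarrow> 'a) set \<Rightarrow> bool"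
  where "subshift A X \<longleftrightarrow> finite A \<and> closedin (full_shift A) X \<and> shift ` X = X"

abbreviation subshift_topology :: "'a set \<Rightarrow> (int \<Rightarrow> 'a) set \<Rightarrow> (int \<Rightarrow> 'a) topology"
  where "subshift_topology A X \<equiv> subtopology (full_shift A) X"

text \<open>The two-sided orbit; the element indexed by \<open>n\<close> is the \<open>n\<close>-th (integer) iterate of the shift.\<close>

definition shift_orbit :: "(int \<Rightarrow> 'a) \<Rightarrow> (int \<Rightarrow> 'a) set"
  where "shift_orbit x = range (\<lambda>n::int. \<lambda>i. x (i + n))"

definition minimal_subshift :: "'a set \<Rightarrow> (int \<Rightarrow> 'a) set \<Rightarrow> bool"
  where "minimal_subshift A X \<longleftrightarrow>
    subshift A X \<and> X \<noteq> {} \<and>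
    (\<forall>x\<in>X. subshift_topology A X closure_of shift_orbit x = X)"

definition complexity :: "'a set \<Rightarrow> (int \<Rightarrow> 'a) set \<Rightarrow> nat \<Rightarrow> nat"
  where "complexity A X n =
    card {w. length w = n \<and> set w \<subseteq> A \<and> (\<exists>x\<in>X. \<forall>i<n. x (int i) = w ! i)}"

text \<open>
  As in \<^const>\<open>BijGroup\<close>, self-maps of \<open>X\<close> are represented by functions that are
  \<^const>\<open>undefined\<close> outside \<open>X\<close>, so that each has exactly one representative.
\<close>

definition Aut :: "'a set \<Rightarrow> (int \<Rightarrow> 'a) set \<Rightarrow> ((int \<Rightarrow> 'a) \<Rightarrow> int \<Rightarrow> 'a) monoid"
  where "Aut A X = BijGroup X
    \<lparr>carrier := {\<phi> \<in> Bij X. homeomorphic_map (subshift_topology A X) (subshift_topology A X) \<phi> \<and>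
                           (\<forall>x\<in>X. \<phi> (shift x) = shift (\<phi> x))}\<rparr>"


section \<open>Properties of groups\<close>

definition finitely_generated_group :: "('g, 'b) monoid_scheme \<Rightarrow> bool"
  where "finitely_generated_group G \<longleftrightarrow>
    (\<exists>S. finite S \<and> S \<subseteq> carrier G \<and> generate G S = carrier G)"

definition torsion_free_group :: "('g, 'b) monoid_scheme \<Rightarrow> bool"
  where "torsion_free_group G \<longleftrightarrow>
    (\<forall>g\<in>carrier G. \<forall>n::nat. n > 0 \<longrightarrow> g [^]\<^bsub>G\<^esub> n = \<one>\<^bsub>G\<^esub> \<longrightarrow> g = \<one>\<^bsub>G\<^esub>)"

definition virtually_abelian_group :: "('g, 'b) monoid_scheme \<Rightarrow> bool"
  where "virtually_abelian_group G \<longleftrightarrow>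
    (\<exists>K. subgroup K G \<and> comm_group (G\<lparr>carrier := K\<rparr>) \<and> finite (rcosets\<^bsub>G\<^esub> K))"


section \<open>The automorphism group is a group\<close>

lemma topspace_subshift: "subshift A X \<Longrightarrow> topspace (subshift_topology A X) = X"
  by (metis closedin_subset subshift_def topspace_subtopology_subset)

lemma subgroup_Aut:
  assumes "subshift A X"
  shows "subgroup (carrier (Aut A X)) (BijGroup X)"
proof -
  interpret B: group "BijGroup X" by (rule group_BijGroup)
  let ?T = "subshift_topology A X"
  have top: "topspace ?T = X" using assms by (rule topspace_subshift)
  have sh: "shift x \<in> X" if "x \<in> X" for x
    using assms that by (auto simp: subshift_def)
  have carr: "carrier (Aut A X) =
    {\<phi> \<in> Bij X. homeomorphic_map ?T ?T \<phi> \<and> (\<forall>x\<in>X. \<phi> (shift x) = shift (\<phi> x))}"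
    by (simp add: Aut_def)
  show ?thesis
  proof (rule B.subgroupI)
    show "carrier (Aut A X) \<subseteq> carrier (BijGroup X)"
      by (auto simp: carr BijGroup_def)
    have "(\<lambda>x\<in>X. x) \<in> carrier (Aut A X)"
      using homeomorphic_map_eq[of ?T ?T id "\<lambda>x\<in>X. x"]
      by (simp add: carr id_Bij top sh)
    then show "carrier (Aut A X) \<noteq> {}" by blast
  next
    fix f assume f: "f \<in> carrier (Aut A X)"
    then have fB: "f \<in> Bij X" and fh: "homeomorphic_map ?T ?T f"
      and fc: "\<And>x. x \<in> X \<Longrightarrow> f (shift x) = shift (f x)" by (auto simp: carr)
    have bij: "bij_betw f X X" using fB by (simp add: Bij_def)
    let ?g = "\<lambda>x\<in>X. inv_into X f x"
    obtain h where h: "homeomorphic_maps ?T ?T f h"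
      using fh homeomorphic_map_maps by blast
    have hh: "homeomorphic_map ?T ?T h"
      using h homeomorphic_maps_map by blast
    have "h x = ?g x" if "x \<in> X" for x
      using h that bij top unfolding homeomorphic_maps_def continuous_map_def
      by (metis (no_types, lifting) Pi_iff bij_betw_inv_into_left restrict_apply')
    then have "homeomorphic_map ?T ?T ?g"
      using homeomorphic_map_eq[OF hh] top by metis
    moreover have "?g (shift x) = shift (?g x)" if "x \<in> X" for x
    proof -
      have y: "inv_into X f x \<in> X" using bij that by (simp add: bij_betw_def inv_into_into)
      have "f (shift (inv_into X f x)) = shift x"
        using fc[OF y] bij that by (simp add: bij_betw_inv_into_right)
      then show ?thesis using that sh y bij
        by (metis bij_betw_inv_into_left restrict_apply')
    qed
    ultimately show "inv\<^bsub>BijGroup X\<^esub> f \<in> carrier (Aut A X)"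
      using fB by (simp add: carr inv_BijGroup restrict_inv_into_Bij)
  next
    fix f g assume f: "f \<in> carrier (Aut A X)" and g: "g \<in> carrier (Aut A X)"
    then have B: "f \<in> Bij X" "g \<in> Bij X" by (auto simp: carr)
    have gX: "g x \<in> X" if "x \<in> X" for x
      using B that Bij_imp_funcset by blast
    have "homeomorphic_map ?T ?T (f \<circ> g)"
      using f g homeomorphic_map_compose by (auto simp: carr)
    then have "homeomorphic_map ?T ?T (compose X f g)"
      by (rule homeomorphic_map_eq) (simp add: compose_def top)
    then show "f \<otimes>\<^bsub>BijGroup X\<^esub> g \<in> carrier (Aut A X)"
      using f g B gX sh by (simp add: carr BijGroup_def compose_Bij compose_eq)
  qed
qed

lemma group_Aut: "subshift A X \<Longrightarrow> group (Aut A X)"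
  using group.subgroup_imp_group[OF group_BijGroup subgroup_Aut, of A X]
  by (simp add: Aut_def)

end

theory Submission
  imports Defs
begin

text \<open>
  Let \<open>\<sigma>\<close> be the shift and \<open>H\<close> the given group of automorphisms. The proof bounds the growth of
  \<open>H\<close> by the complexity of \<open>X\<close> and then gains one degree from the fact that \<open>\<sigma>\<close> is central in
  \<open>Aut X\<close>; this leaves groups of growth below \<open>n\<^sup>2\<close>, which have an elementary theory, so that
  Gromov's theorem on polynomial growth can be avoided.

  Dynamics. An automorphism is a sliding block code of some radius. Suppose that a word \<open>w\<close> of
  length \<open>k\<close> determines the \<open>2 r\<close> letters on either side of each of its occurrences. If \<open>\<phi>\<close> and
  \<open>\<psi>\<close> have radius \<open>r\<close>, together with their inverses, and send \<open>w\<close> to the same word of length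
  \<open>k + 2 r\<close>, then \<open>\<phi>\<inverse> \<psi>\<close> preserves the occurrences of \<open>w\<close> and hence permutes the blocks between
  them, of which there are finitely many by minimality; so it has finite order (\<open>finite_order_if_equal_images\<close>). Among
  automorphisms whose quotients \<open>\<phi>\<inverse> \<psi>\<close> are not nontrivial torsion elements, at most
  \<open>P (k + 2 r)\<close> therefore have radius \<open>r\<close>. A suitable \<open>w\<close> exists as soon as
  \<open>P (k + 4 r) < 2 P k\<close>. Because \<open>P\<close> is at most cubic, this holds with \<open>k = 20 r\<close> for infinitely
  many \<open>r\<close> (\<open>not_doubling_infinitely_often\<close>).

  Growth. If \<open>\<sigma>\<close> has finite order, then \<open>Aut X\<close> is finite. Otherwise, for a suitable power \<open>z\<close> of
  \<open>\<sigma>\<close>, the group generated by \<open>H\<close> and \<open>z\<close> is torsion free.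
  The elements \<open>g z\<^sup>i\<close> with \<open>g\<close> in the ball of radius \<open>n\<close> and \<open>i < n\<close> have radius linear in \<open>n\<close>,
  so for infinitely many \<open>n\<close> there are only \<open>o(n\<^sup>3)\<close> of them (\<open>subcubic_growth\<close>).

  Group theory. The image of \<open>H\<close> modulo \<open>\<langle>z\<rangle>\<close> then has growth \<open>o(n\<^sup>2)\<close> along a sequence. If this
  image is finite, \<open>H \<inter> \<langle>z\<rangle>\<close> has finite index in \<open>H\<close>. If it is infinite, it contains an element of infinite order: the least words
  representing its elements form a language with at most \<open>j\<close> words of some length \<open>j\<close>, and by
  the theorem of Morse and Hedlund an infinite sequence in such a language is eventually periodic.
  Lifting the element to \<open>h \<in> H\<close> gives a free abelian group \<open>\<langle>h, z\<rangle>\<close> of rank two, and if its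
  cosets were infinite in number, the growth would be at least cubic
  (\<open>virtually_abelian_if_subcubic_growth\<close>).
\<close>

section \<open>Periodicity of sequences with few windows\<close>

definition window :: "(nat \<Rightarrow> 'a) \<Rightarrow> nat \<Rightarrow> nat \<Rightarrow> 'a list"
  where "window f i n = map (\<lambda>j. f (i + j)) [0..<n]"

lemma window_eq_iff: "window f i n = window f i' n \<longleftrightarrow> (\<forall>j<n. f (i + j) = f (i' + j))"
  by (auto simp: window_def)

lemma take_window: "m \<le> n \<Longrightarrow> take m (window f i n) = window f i m"
  by (simp add: window_def take_map)

lemma finite_windows:
  assumes "finite (range f)"
  shows "finite (range (\<lambda>i. window f i n))"
proof (rule finite_subset)
  show "range (\<lambda>i. window f i n) \<subseteq> {w. set w \<subseteq> range f \<and> length w = n}"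
    by (auto simp: window_def)
  show "finite {w. set w \<subseteq> range f \<and> length w = n}"
    using assms by (rule finite_lists_length_eq)
qed

text \<open>
  This is the theorem of Morse and Hedlund. The number of windows of length \<open>j\<close> cannot increase
  strictly \<open>n\<close> times from its initial value 1, or it would exceed \<open>n\<close>, so at some length \<open>j\<close> every window determines the
  letter that follows it. From then on the sequence is driven by a map on the finite set of
  windows of length \<open>j\<close>.
\<close>

theorem eventually_periodic_if_few_windows:
  fixes f :: "nat \<Rightarrow> 'a"
  assumes fin: "finite (range f)" and few: "card (range (\<lambda>i. window f i n)) \<le> n"
  shows "\<exists>p>0. \<exists>i0. \<forall>i\<ge>i0. f (i + p) = f i"
proof -
  define W where "W j = range (\<lambda>i. window f i j)" for j
  have finW: "finite (W j)" for j
    using finite_windows[OF fin] by (simp add: W_def)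
  have "\<exists>j. card (W (Suc j)) \<le> card (W j)"
  proof (rule ccontr)
    assume "\<nexists>j. card (W (Suc j)) \<le> card (W j)"
    then have step: "card (W j) < card (W (Suc j))" for j by (simp add: not_le)
    have "j < card (W j)" for j
    proof (induction j)
      case 0
      then show ?case using finW by (simp add: W_def card_gt_0_iff)
    next
      case (Suc j)
      then show ?case using step[of j] by linarith
    qed
    from this[of n] show False using few by (simp add: W_def)
  qed
  then obtain j where j: "card (W (Suc j)) \<le> card (W j)" ..
  have img: "take j ` W (Suc j) = W j"
    by (simp add: W_def image_image take_window)
  have inj: "inj_on (take j) (W (Suc j))"
    using j img finW by (metis card_image_le eq_card_imp_inj_on le_antisym)
  have det: "window f (Suc i) j = window f (Suc i') j \<and> f (i + j) = f (i' + j)"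
    if "window f i j = window f i' j" for i i'
  proof -
    have "window f i (Suc j) = window f i' (Suc j)"
      using inj_onD[OF inj, of "window f i (Suc j)" "window f i' (Suc j)"] that
      by (simp add: take_window W_def)
    then have *: "f (i + t) = f (i' + t)" if "t < Suc j" for t
      using that by (simp add: window_eq_iff)
    have "f (Suc i + t) = f (Suc i' + t)" if "t < j" for t
      using *[of "Suc t"] that by simp
    then show ?thesis using *[of j] by (simp add: window_eq_iff)
  qed
  have "\<not> inj (\<lambda>i. window f i j)"
    using finW[of j] unfolding W_def by (metis finite_imageD infinite_UNIV_nat)
  then obtain a b where "a \<noteq> b" "window f a j = window f b j"
    by (auto simp: inj_def)
  then obtain a b where ab: "a < b" "window f a j = window f b j"
    by (metis nat_neq_iff)
  have win: "window f (a + t) j = window f (b + t) j" for t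
  proof (induction t)
    case 0
    then show ?case using ab(2) by simp
  next
    case (Suc t)
    then show ?case using det[OF Suc] by simp
  qed
  have "f (i + (b - a)) = f i" if i: "i \<ge> a + j" for i
  proof -
    define t where "t = i - (a + j)"
    have "f (a + t + j) = f (b + t + j)"
      using det[OF win[of t]] by simp
    moreover have "a + t + j = i" "b + t + j = i + (b - a)"
      using i ab(1) by (auto simp: t_def)
    ultimately show ?thesis by simp
  qed
  moreover have "b - a > 0" using ab(1) by simp
  ultimately show ?thesis by blast
qed

text \<open>
  This is Koenig's lemma for the tree of words of \<open>L\<close>: a word with infinitely many extensions
  in \<open>L\<close> has, the alphabet being finite, a one-letter extension with the same property.
\<close>

lemma infinite_word_with_prefixes_in:
  assumes fin: "finite S" and inf: "infinite L" and sub: "L \<subseteq> lists S"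
    and prefix: "\<And>u v. u @ v \<in> L \<Longrightarrow> u \<in> L"
  shows "\<exists>f :: nat \<Rightarrow> 'a. \<forall>n. map f [0..<n] \<in> L"
proof -
  define E where "E w \<longleftrightarrow> infinite {v. w @ v \<in> L}" for w
  have E_Nil: "E []" using inf by (simp add: E_def)
  have E_step: "\<exists>a. E (w @ [a])" if "E w" for w
  proof (rule ccontr)
    assume "\<nexists>a. E (w @ [a])"
    then have "finite {v. (w @ [a]) @ v \<in> L}" for a by (simp add: E_def)
    then have "finite (insert [] (\<Union>a\<in>S. (#) a ` {v. (w @ [a]) @ v \<in> L}))"
      using fin by blast
    moreover have "{v. w @ v \<in> L} \<subseteq> insert [] (\<Union>a\<in>S. (#) a ` {v. (w @ [a]) @ v \<in> L})"
    proof
      fix v assume v: "v \<in> {v. w @ v \<in> L}"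
      show "v \<in> insert [] (\<Union>a\<in>S. (#) a ` {v. (w @ [a]) @ v \<in> L})"
      proof (cases v)
        case (Cons a v')
        then have "w @ a # v' \<in> L" using v by simp
        then have "a \<in> S" using sub by fastforce
        then show ?thesis using v Cons by auto
      qed simp
    qed
    ultimately show False using that finite_subset unfolding E_def by blast
  qed
  have "\<exists>W. W 0 = [] \<and> (\<forall>n. E (W n) \<and> (\<exists>a. W (Suc n) = W n @ [a]))"
    using dependent_nat_choice[of "\<lambda>n w. E w \<and> (n = 0 \<longrightarrow> w = [])" "\<lambda>_ w w'. \<exists>a. w' = w @ [a]"]
      E_Nil E_step by (metis nat.distinct(1))
  then obtain W where W: "W 0 = []" "\<And>n. E (W n)" "\<And>n. \<exists>a. W (Suc n) = W n @ [a]" by blast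
  define f where "f n = last (W (Suc n))" for n
  have "W n = map f [0..<n]" for n
  proof (induction n)
    case (Suc n)
    obtain a where a: "W (Suc n) = W n @ [a]" using W(3) by blast
    then have "f n = a" by (simp add: f_def)
    then show ?case using Suc a by simp
  qed (simp add: W)
  moreover have "W n \<in> L" for n
  proof -
    have "{v. W n @ v \<in> L} \<noteq> {}" using W(2)[of n] unfolding E_def by (metis finite.emptyI)
    then show ?thesis using prefix by blast
  qed
  ultimately show ?thesis by metis
qed

section \<open>Infinite groups of small growth have elements of infinite order\<close>

definition word_value :: "('g, 'b) monoid_scheme \<Rightarrow> 'g list \<Rightarrow> 'g"
  where "word_value G w = foldr (\<lambda>a b. a \<otimes>\<^bsub>G\<^esub> b) w \<one>\<^bsub>G\<^esub>"

definition word_ball :: "('g, 'b) monoid_scheme \<Rightarrow> 'g set \<Rightarrow> nat \<Rightarrow> 'g set"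
  where "word_ball G S n = word_value G ` {w. set w \<subseteq> S \<and> length w \<le> n}"

lemma finite_word_ball: "finite S \<Longrightarrow> finite (word_ball G S n)"
  by (simp add: word_ball_def finite_lists_length_le)

lemma word_ball_mono: "m \<le> n \<Longrightarrow> word_ball G S m \<subseteq> word_ball G S n"
  by (auto simp: word_ball_def)

lemma ex_wf_total_irrefl: "\<exists>r :: 'a rel. wf r \<and> total r \<and> irrefl r"
proof -
  obtain r :: "'a rel" where r: "well_order_on UNIV r"
    using well_order_on by blast
  then have wf: "wf (r - Id)" and tot: "total_on UNIV r"
    by (simp_all add: well_order_on_def linear_order_on_def)
  moreover have "irrefl (r - Id)" by (simp add: irrefl_def)
  ultimately show ?thesis using total_on_diff_Id by blast
qed

context group
begin

lemma word_value_closed: "set w \<subseteq> carrier G \<Longrightarrow> word_value G w \<in> carrier G"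
  by (induction w) (auto simp: word_value_def)

lemma word_value_append:
  "set u \<subseteq> carrier G \<Longrightarrow> set v \<subseteq> carrier G \<Longrightarrow>
    word_value G (u @ v) = word_value G u \<otimes> word_value G v"
proof (induction u)
  case Nil
  then show ?case using word_value_closed[of v] by (simp add: word_value_def)
next
  case (Cons a u)
  then show ?case using word_value_closed[of u] word_value_closed[of v]
    by (simp add: word_value_def m_assoc)
qed

lemma word_value_singleton: "s \<in> carrier G \<Longrightarrow> word_value G [s] = s"
  by (simp add: word_value_def)

lemma word_ball_closed: "S \<subseteq> carrier G \<Longrightarrow> word_ball G S n \<subseteq> carrier G"
  using word_value_closed by (auto simp: word_ball_def)

lemma one_in_word_ball: "\<one> \<in> word_ball G S n"
  by (auto simp: word_ball_def word_value_def intro: image_eqI[of _ _ "[]"])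

lemma word_ball_mult:
  assumes "S \<subseteq> carrier G" "g \<in> word_ball G S m" "h \<in> word_ball G S n"
  shows "g \<otimes> h \<in> word_ball G S (m + n)"
proof -
  obtain u v where "set u \<subseteq> S" "length u \<le> m" "g = word_value G u"
    "set v \<subseteq> S" "length v \<le> n" "h = word_value G v"
    using assms by (auto simp: word_ball_def)
  then show ?thesis using assms(1)
    by (auto simp: word_ball_def word_value_append intro!: image_eqI[of _ _ "u @ v"])
qed

lemma generate_eq_word_balls:
  assumes S: "S \<subseteq> carrier G"
  shows "generate G S = (\<Union>n. word_ball G (S \<union> m_inv G ` S) n)"
proof
  define S' where "S' = S \<union> m_inv G ` S"
  have S': "S' \<subseteq> carrier G" using S by (auto simp: S'_def)
  have gen: "s \<in> word_ball G S' 1" if "s \<in> S'" for s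
    using that S' by (auto simp: word_ball_def word_value_singleton intro!: image_eqI[of _ _ "[s]"])
  have "g \<in> (\<Union>n. word_ball G S' n)" if "g \<in> generate G S" for g
    using that
  proof induction
    case one
    then show ?case using one_in_word_ball by blast
  next
    case (incl h)
    then show ?case using gen[of h] by (auto simp: S'_def)
  next
    case (inv h)
    then show ?case using gen[of "inv h"] by (auto simp: S'_def)
  next
    case (eng g h)
    then obtain m n where "g \<in> word_ball G S' m" "h \<in> word_ball G S' n" by blast
    then show ?case using word_ball_mult[OF S'] by blast
  qed
  then show "generate G S \<subseteq> (\<Union>n. word_ball G (S \<union> m_inv G ` S) n)" by (auto simp: S'_def)
  have "word_value G w \<in> generate G S" if "set w \<subseteq> S'" for w
    using that
    by (induction w) (auto simp: word_value_def S'_def intro: generate.intros)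
  then show "(\<Union>n. word_ball G (S \<union> m_inv G ` S) n) \<subseteq> generate G S"
    by (auto simp: word_ball_def S'_def)
qed

text \<open>
  The words that are least for the length-lexicographic order among the words with their value.
  If the order \<open>r\<close> of the letters is total and well-founded, they form a set of unique representatives by shortest words, and the order is compatible with
  concatenation, which makes the set closed under factors.
\<close>

definition normal_words :: "('a \<times> 'a) set \<Rightarrow> 'a set \<Rightarrow> 'a list set"
  where "normal_words r S =
    {w. set w \<subseteq> S \<and> (\<forall>v. set v \<subseteq> S \<longrightarrow> word_value G v = word_value G w \<longrightarrow> (v, w) \<notin> lenlex r)}"

lemma normal_words_factor:
  assumes S: "S \<subseteq> carrier G" and r: "irrefl r" and w: "u @ w @ v \<in> normal_words r S"
  shows "w \<in> normal_words r S"
proof -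
  have sub: "set u \<subseteq> S" "set w \<subseteq> S" "set v \<subseteq> S" using w by (auto simp: normal_words_def)
  have "(w', w) \<notin> lenlex r" if w': "set w' \<subseteq> S" "word_value G w' = word_value G w" for w'
  proof
    assume less: "(w', w) \<in> lenlex r"
    have "(w' @ v, w @ v) \<in> lenlex r" using lenlex_append1[OF less] by simp
    then have "(u @ w' @ v, u @ w @ v) \<in> lenlex r" using r by simp
    moreover have "word_value G (u @ w' @ v) = word_value G (u @ w @ v)"
      using sub w' S by (simp add: word_value_append subset_trans[of _ S])
    moreover have "set (u @ w' @ v) \<subseteq> S" using sub w' by simp
    ultimately show False using w by (auto simp: normal_words_def)
  qed
  then show ?thesis using sub by (simp add: normal_words_def)
qed

lemma normal_word_exists:
  assumes r: "wf r" and w: "set w \<subseteq> S"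
  shows "\<exists>v\<in>normal_words r S. word_value G v = word_value G w \<and> length v \<le> length w"
proof -
  let ?Q = "{v. set v \<subseteq> S \<and> word_value G v = word_value G w \<and> length v \<le> length w}"
  obtain v where v: "v \<in> ?Q" and least: "\<And>u. (u, v) \<in> lenlex r \<Longrightarrow> u \<notin> ?Q"
    using wfE_min[OF wf_lenlex[OF r], of w ?Q] w by (metis (mono_tags, lifting) le_refl mem_Collect_eq)
  have "v \<in> normal_words r S"
    unfolding normal_words_def
  proof (intro CollectI conjI allI impI)
    show "set v \<subseteq> S" using v by simp
    fix u assume u: "set u \<subseteq> S" "word_value G u = word_value G v"
    show "(u, v) \<notin> lenlex r"
    proof
      assume "(u, v) \<in> lenlex r"
      then show False using least[of u] lenlex_length[of u v r] u v by auto
    qed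
  qed
  then show ?thesis using v by blast
qed

lemma inj_on_normal_words:
  assumes "total r"
  shows "inj_on (word_value G) (normal_words r S)"
proof (rule inj_onI)
  fix u v assume "u \<in> normal_words r S" "v \<in> normal_words r S" "word_value G u = word_value G v"
  then show "u = v"
    using total_lenlex[OF assms] unfolding total_on_def normal_words_def
    by (metis (mono_tags, lifting) UNIV_I mem_Collect_eq)
qed

text \<open>
  Since \<open>1 + 2 + \<dots> + (n + 1)\<close> exceeds \<open>n\<^sup>2 / 2\<close>, there are at most \<open>j\<close> normal words of some length
  \<open>j \<le> n\<close>. An infinite sequence whose prefixes are all normal therefore has at most \<open>j\<close> windows of
  length \<open>j\<close> and is eventually periodic. The powers of its period are then normal words, and the
  only normal word with value \<open>\<one>\<close> is the empty one.
\<close>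

theorem infinite_order_element_if_few_elements_in_ball:
  assumes fin: "finite S" and S: "S \<subseteq> carrier G"
    and inf: "infinite (\<Union>n. word_ball G S n)" and few: "2 * card (word_ball G S n) \<le> n ^ 2"
  shows "\<exists>m. \<exists>g\<in>word_ball G S m. \<forall>k>0. g [^] (k::nat) \<noteq> \<one>"
proof -
  obtain r :: "'a rel" where r: "wf r" "total r" "irrefl r"
    using ex_wf_total_irrefl by blast
  define L where "L = normal_words r S"
  have L_S: "set w \<subseteq> S" if "w \<in> L" for w using that by (simp add: L_def normal_words_def)
  have factor: "w \<in> L" if "u @ w @ v \<in> L" for u v w
    using normal_words_factor[OF S r(3)] that unfolding L_def .
  have inj: "inj_on (word_value G) L"
    using inj_on_normal_words[OF r(2)] by (simp add: L_def)
  define Lj where "Lj j = {w \<in> L. length w = j}" for j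
  have finLj: "finite (Lj j)" for j
    by (rule finite_subset[OF _ finite_lists_length_eq[OF fin, of j]]) (auto simp: Lj_def dest: L_S)
  have "\<exists>j. card (Lj j) \<le> j"
  proof (rule ccontr)
    assume "\<nexists>j. card (Lj j) \<le> j"
    then have big: "Suc j \<le> card (Lj j)" for j by (simp add: not_le Suc_le_eq)
    have "(\<Sum>j\<le>n. Suc j) \<le> (\<Sum>j\<le>n. card (Lj j))"
      by (rule sum_mono) (rule big)
    also have "\<dots> = card (\<Union>j\<le>n. Lj j)"
      by (rule card_UN_disjoint[symmetric]) (use finLj in \<open>auto simp: Lj_def\<close>)
    also have "\<dots> \<le> card (word_ball G S n)"
    proof (rule card_inj_on_le)
      show "inj_on (word_value G) (\<Union>j\<le>n. Lj j)"
        by (rule inj_on_subset[OF inj]) (auto simp: Lj_def)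
      show "word_value G ` (\<Union>j\<le>n. Lj j) \<subseteq> word_ball G S n"
        using L_S by (auto simp: Lj_def word_ball_def)
      show "finite (word_ball G S n)" using fin by (rule finite_word_ball)
    qed
    finally have "2 * (\<Sum>j\<le>n. Suc j) \<le> n ^ 2" using few by linarith
    moreover have "2 * (\<Sum>j\<le>n. Suc j) = (n + 1) * (n + 2)" for n
      by (induction n) auto
    ultimately show False by (simp add: power2_eq_square)
  qed
  then obtain j where j: "card (Lj j) \<le> j" ..
  have infL: "infinite L"
  proof
    assume "finite L"
    moreover have "(\<Union>n. word_ball G S n) \<subseteq> word_value G ` L"
    proof
      fix g assume "g \<in> (\<Union>n. word_ball G S n)"
      then obtain w where "set w \<subseteq> S" "g = word_value G w" by (auto simp: word_ball_def)
      then show "g \<in> word_value G ` L"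
        using normal_word_exists[OF r(1), of w S] by (auto simp: L_def intro: rev_image_eqI)
    qed
    ultimately show False using inf finite_surj by blast
  qed
  have "\<exists>f :: nat \<Rightarrow> 'a. \<forall>n. map f [0..<n] \<in> L"
    by (rule infinite_word_with_prefixes_in[OF fin infL]) (use L_S factor[of "[]"] in auto)
  then obtain f :: "nat \<Rightarrow> 'a" where f: "\<And>n. map f [0..<n] \<in> L" by blast
  have win: "window f i n \<in> L" for i n
  proof -
    have "map f [0..<i + n] = map f [0..<i] @ window f i n"
      by (rule nth_equalityI) (auto simp: window_def nth_append)
    then show ?thesis using f[of "i + n"] factor[of "map f [0..<i]" "window f i n" "[]"] by simp
  qed
  have "f i \<in> S" for i
    using L_S[OF win[of i 1]] by (simp add: window_def)
  then have "finite (range f)" using fin by (meson finite_subset image_subsetI)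
  moreover have "card (range (\<lambda>i. window f i j)) \<le> j"
  proof -
    have "range (\<lambda>i. window f i j) \<subseteq> Lj j" using win by (auto simp: Lj_def window_def)
    then show ?thesis using card_mono[OF finLj] j le_trans by blast
  qed
  ultimately obtain p i0 where p: "p > 0" and per: "\<And>i. i \<ge> i0 \<Longrightarrow> f (i + p) = f i"
    using eventually_periodic_if_few_windows[of f j] by blast
  define g where "g = word_value G (window f i0 p)"
  have wS: "set (window f i n) \<subseteq> carrier G" for i n using L_S[OF win] S by blast
  have per': "f (i + k * p) = f i" if "i \<ge> i0" for i k
  proof (induction k)
    case (Suc k)
    have "f (i + Suc k * p) = f (i + k * p + p)" by (simp add: algebra_simps)
    then show ?case using per[of "i + k * p"] that Suc by simp
  qed simp
  have pow: "word_value G (window f i0 (k * p)) = g [^] k" for k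
  proof (induction k)
    case 0
    then show ?case by (simp add: window_def word_value_def)
  next
    case (Suc k)
    have "window f i0 (Suc k * p) = window f i0 (k * p) @ window f (i0 + k * p) p"
      by (rule nth_equalityI) (auto simp: window_def nth_append)
    also have "window f (i0 + k * p) p = window f i0 p"
    proof -
      have "f (i0 + k * p + t) = f (i0 + t)" for t
        using per'[of "i0 + t" k] by (simp add: algebra_simps)
      then show ?thesis by (simp add: window_def)
    qed
    finally show ?case using Suc wS by (simp add: word_value_append g_def)
  qed
  have "g [^] k \<noteq> \<one>" if "k > 0" for k :: nat
  proof
    assume "g [^] k = \<one>"
    then have "word_value G (window f i0 (k * p)) = word_value G []"
      by (simp add: pow) (simp add: word_value_def)
    moreover have "[] \<in> L" using f[of 0] by simp
    ultimately have "window f i0 (k * p) = []"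
      using inj_onD[OF inj] win by blast
    then show False using that p by (simp add: window_def)
  qed
  moreover have "g \<in> word_ball G S p"
    using L_S[OF win[of i0 p]] by (auto simp: g_def word_ball_def window_def)
  ultimately show ?thesis by blast
qed

section \<open>Virtually abelian groups of subcubic growth\<close>

lemma word_ball_Suc:
  assumes "S \<subseteq> carrier G"
  shows "word_ball G S (Suc n) = word_ball G S n \<union> {g \<otimes> s | g s. g \<in> word_ball G S n \<and> s \<in> S}"
proof
  show "word_ball G S (Suc n) \<subseteq> word_ball G S n \<union> {g \<otimes> s | g s. g \<in> word_ball G S n \<and> s \<in> S}"
  proof
    fix x assume "x \<in> word_ball G S (Suc n)"
    then obtain w where w: "set w \<subseteq> S" "length w \<le> Suc n" "x = word_value G w"
      by (auto simp: word_ball_def)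
    show "x \<in> word_ball G S n \<union> {g \<otimes> s | g s. g \<in> word_ball G S n \<and> s \<in> S}"
    proof (cases w rule: rev_cases)
      case Nil
      then show ?thesis using w by (auto simp: word_ball_def)
    next
      case (snoc u s)
      then have "x = word_value G u \<otimes> s" "word_value G u \<in> word_ball G S n" "s \<in> S"
        using w assms word_value_append[of u "[s]"]
        by (auto simp: word_ball_def word_value_singleton subset_trans[of _ S] subsetD)
      then show ?thesis by blast
    qed
  qed
  have "s \<in> word_ball G S 1" if "s \<in> S" for s
    using that assms by (auto simp: word_ball_def word_value_singleton intro!: image_eqI[of _ _ "[s]"])
  then show "word_ball G S n \<union> {g \<otimes> s | g s. g \<in> word_ball G S n \<and> s \<in> S} \<subseteq> word_ball G S (Suc n)"
    using word_ball_mult[OF assms, of _ n _ 1] word_ball_mono[of n "Suc n" G S] by auto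
qed

text \<open>
  Right cosets of \<open>A\<close> are permuted by right multiplication with the generators, so they form a
  connected graph, and a connected infinite graph has more than \<open>n\<close> vertices within distance \<open>n\<close>
  from any given one.
\<close>

lemma card_cosets_of_word_ball:
  assumes fin: "finite S" and S: "S \<subseteq> carrier G" and A: "subgroup A G"
    and inf: "infinite ((\<lambda>g. A #> g) ` (\<Union>n. word_ball G S n))"
  shows "n < card ((\<lambda>g. A #> g) ` word_ball G S n)"
proof -
  define C where "C n = (\<lambda>g. A #> g) ` word_ball G S n" for n
  have finC: "finite (C n)" for n by (simp add: C_def finite_word_ball[OF fin])
  have AG: "A \<subseteq> carrier G" using A by (rule subgroup.subset)
  have C_Suc: "C (Suc n) = C n \<union> {c #> s | c s. c \<in> C n \<and> s \<in> S}" for n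
  proof -
    have "A #> (g \<otimes> s) = (A #> g) #> s" if "g \<in> word_ball G S n" "s \<in> S" for g s
      using that coset_mult_assoc[OF AG] S word_ball_closed[OF S] by (metis subsetD)
    then show ?thesis unfolding C_def word_ball_Suc[OF S] image_Un by (fastforce simp: image_iff)
  qed
  have strict: "C n \<subset> C (Suc n)" for n
  proof (rule ccontr)
    assume "\<not> C n \<subset> C (Suc n)"
    then have stable: "C (Suc n) = C n" using C_Suc by blast
    have "C (n + k) = C n" for k
    proof (induction k)
      case (Suc k)
      have "C (n + Suc k) = C (Suc n)"
        by (simp only: add_Suc_right C_Suc Suc)
      then show ?case by (simp only: stable)
    qed simp
    then have "C m \<subseteq> C n" for m
      using word_ball_mono[of m "n + m" G S] unfolding C_def by (metis image_mono le_add2)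
    then have "(\<lambda>g. A #> g) ` (\<Union>n. word_ball G S n) \<subseteq> C n"
      unfolding C_def by blast
    then show False using inf finC finite_subset by blast
  qed
  have "n < card (C n)"
  proof (induction n)
    case 0
    have "C 0 \<noteq> {}" using one_in_word_ball by (auto simp: C_def)
    then show ?case using finC by (simp add: card_gt_0_iff)
  next
    case (Suc n)
    then show ?case using psubset_card_mono[OF finC strict, of n] by linarith
  qed
  then show ?thesis by (simp add: C_def)
qed

text \<open>The coset of \<open>H \<inter> A\<close> by an element \<open>g\<close> of \<open>H\<close> is the trace on \<open>H\<close> of the coset of \<open>A\<close> by \<open>g\<close>.\<close>

lemma virtually_abelian_if_finitely_many_cosets:
  assumes H: "subgroup H G" and A: "subgroup A G"
    and comm: "\<And>a b. a \<in> A \<Longrightarrow> b \<in> A \<Longrightarrow> a \<otimes> b = b \<otimes> a"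
    and fin: "finite ((\<lambda>g. A #> g) ` H)"
  shows "virtually_abelian_group (G\<lparr>carrier := H\<rparr>)"
proof -
  define K where "K = H \<inter> A"
  have K: "subgroup K G" using subgroups_Inter_pair[OF H A] by (simp add: K_def)
  have "subgroup K (G\<lparr>carrier := H\<rparr>)"
    by (rule subgroup_incl[OF K H]) (simp add: K_def)
  moreover have "comm_group (G\<lparr>carrier := K\<rparr>)"
    by (rule group.group_comm_groupI[OF subgroup_imp_group[OF K]]) (auto simp: K_def comm)
  moreover have "finite (rcosets\<^bsub>G\<lparr>carrier := H\<rparr>\<^esub> K)"
  proof (rule finite_subset[OF _ finite_imageI[OF fin, of "\<lambda>C. H \<inter> C"]])
    have "K #> g = H \<inter> (A #> g)" if g: "g \<in> H" for g
    proof
      show "K #> g \<subseteq> H \<inter> (A #> g)"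
        using g subgroup.m_closed[OF H] by (auto simp: K_def r_coset_def)
      show "H \<inter> (A #> g) \<subseteq> K #> g"
      proof
        fix x assume "x \<in> H \<inter> (A #> g)"
        then obtain a where a: "a \<in> A" "x = a \<otimes> g" and x: "x \<in> H" by (auto simp: r_coset_def)
        have carr: "a \<in> carrier G" "g \<in> carrier G"
          using a g A H subgroup.mem_carrier by metis+
        then have "a = x \<otimes> inv g" using a by (simp add: m_assoc)
        then have "a \<in> H" using x g subgroup.m_closed[OF H] subgroup.m_inv_closed[OF H] by metis
        then show "x \<in> K #> g" using a by (auto simp: K_def r_coset_def)
      qed
    qed
    then show "rcosets\<^bsub>G\<lparr>carrier := H\<rparr>\<^esub> K \<subseteq> (\<lambda>C. H \<inter> C) ` (\<lambda>g. A #> g) ` H"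
      by (auto simp: RCOSETS_def)
  qed
  ultimately show ?thesis unfolding virtually_abelian_group_def by auto
qed

lemma int_pow_commute:
  assumes x: "x \<in> carrier G" and y: "y \<in> carrier G" and eq: "x \<otimes> y = y \<otimes> x"
  shows "x [^] (k::int) \<otimes> y = y \<otimes> x [^] k"
proof -
  have nat: "x [^] (n::nat) \<otimes> y = y \<otimes> x [^] n" for n
  proof (induction n)
    case (Suc n)
    have "x [^] Suc n \<otimes> y = x [^] n \<otimes> (x \<otimes> y)" using x y by (simp add: m_assoc)
    also have "\<dots> = (x [^] n \<otimes> y) \<otimes> x" unfolding eq using x y by (simp add: m_assoc)
    also have "\<dots> = y \<otimes> x [^] Suc n" unfolding Suc using x y by (simp add: m_assoc)
    finally show ?case .
  qed (use y in simp)
  show ?thesis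
  proof (cases k rule: int_cases2)
    case (nonneg n)
    then show ?thesis using nat by (simp add: int_pow_int)
  next
    case (nonpos n)
    define w where "w = x [^] n"
    have w: "w \<in> carrier G" "w \<otimes> y = y \<otimes> w" using nat x by (simp_all add: w_def)
    have "inv w \<otimes> y = inv w \<otimes> (y \<otimes> w) \<otimes> inv w" using w(1) y by (simp add: m_assoc)
    also have "\<dots> = inv w \<otimes> (w \<otimes> y) \<otimes> inv w" by (simp only: w(2))
    also have "\<dots> = y \<otimes> inv w" using w(1) y by (simp flip: m_assoc)
    finally show ?thesis using x by (simp add: nonpos w_def int_pow_neg_int)
  qed
qed

lemma int_pow_neq_one:
  assumes z: "z \<in> carrier G" and "\<And>k::nat. k > 0 \<Longrightarrow> z [^] k \<noteq> \<one>"
    and "z [^] (b::int) = \<one>"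
  shows "b = 0"
proof (rule ccontr)
  assume b: "b \<noteq> 0"
  have "z [^] (\<bar>b\<bar>) = \<one>"
    using assms(3) z by (cases "b < 0") (auto simp: int_pow_neg abs_if)
  then have "z [^] (nat \<bar>b\<bar>) = \<one>"
    by (metis abs_ge_zero int_pow_int nat_0_le)
  then show False using assms(2)[of "nat \<bar>b\<bar>"] b by simp
qed

text \<open>
  The products of the elements \<open>h\<^sup>a z\<^sup>b\<close> with representatives of the cosets of \<open>A\<close> are distinct.
  The exponents \<open>a\<close> and \<open>b\<close> contribute one degree of growth each, and infinitely many cosets
  contribute at least a third. The powers of \<open>z\<close> are counted separately because \<open>z\<close> may lie
  outside the group generated by \<open>S\<close>.
\<close>

lemma cubic_growth_if_infinitely_many_cosets:
  assumes fin: "finite S" and S: "S \<subseteq> carrier G" and z: "z \<in> carrier G"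
    and central: "\<And>g. g \<in> carrier G \<Longrightarrow> z \<otimes> g = g \<otimes> z"
    and indep: "\<And>(a::int) (b::int). h [^] a = z [^] b \<Longrightarrow> a = 0 \<and> b = 0"
    and h: "h \<in> word_ball G S l"
    and A: "subgroup A G" and hzA: "h \<in> A" "z \<in> A"
    and inf: "infinite ((\<lambda>g. A #> g) ` (\<Union>n. word_ball G S n))"
  shows "N ^ 3 \<le> (l + 1)\<^sup>2 * card {g \<otimes> z [^] i | g (i::nat). g \<in> word_ball G S N \<and> i < N}"
proof -
  \<comment> \<open>With this \<open>n\<close>, the products \<open>h ^ a g\<close> with \<open>a \<le> n\<close> and \<open>g\<close> of length \<open>n\<close> have length
    at most \<open>N\<close>.\<close>
  define n where "n = N div (l + 1)"
  define F where "F = {g \<otimes> z [^] i | g (i::nat). g \<in> word_ball G S N \<and> i < N}"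
  have hG: "h \<in> carrier G" using h word_ball_closed[OF S] by blast
  have BG: "g \<in> carrier G" if "g \<in> word_ball G S k" for g k
    using word_ball_closed[OF S] that by blast
  obtain R where R: "R \<subseteq> word_ball G S n" "inj_on (\<lambda>g. A #> g) R"
      "(\<lambda>g. A #> g) ` word_ball G S n = (\<lambda>g. A #> g) ` R"
    using subset_image_inj[of "(\<lambda>g. A #> g) ` word_ball G S n" "\<lambda>g. A #> g" "word_ball G S n"] by auto
  have cardR: "n + 1 \<le> card R"
    using card_cosets_of_word_ball[OF fin S A inf, of n] card_image[OF R(2)] by (simp add: R(3))
  have finF: "finite F"
  proof -
    have "F = (\<lambda>(g, i). g \<otimes> z [^] i) ` (word_ball G S N \<times> {..<N})" by (auto simp: F_def)
    then show ?thesis by (simp add: finite_word_ball[OF fin])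
  qed
  have pow_ball: "h [^] a \<in> word_ball G S (a * l)" for a :: nat
  proof (induction a)
    case 0
    then show ?case using one_in_word_ball by simp
  next
    case (Suc a)
    then show ?case using word_ball_mult[OF S Suc h] by (simp add: add.commute)
  qed
  define m where "m = (\<lambda>(a::nat, b::nat, g). (h [^] a \<otimes> g) \<otimes> z [^] b)"
  have m_inj: "a = a' \<and> b = b' \<and> g = g'"
    if g: "g \<in> R" "g' \<in> R" and eq: "m (a, b, g) = m (a', b', g')" for a b a' b' g g'
  proof -
    have gG: "g \<in> carrier G" "g' \<in> carrier G" using g R(1) BG by blast+
    have zc: "z [^] k \<otimes> x = x \<otimes> z [^] k" if "x \<in> carrier G" for x and k :: nat
      using int_pow_commute[OF z that central[OF that], of "int k"] by (simp add: int_pow_int)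
    have m: "m (a, b, g) = (z [^] b \<otimes> h [^] a) \<otimes> g" if "g \<in> carrier G" for a b g
      unfolding m_def using zc[of "h [^] a \<otimes> g" b] that hG z by (simp add: m_assoc)
    have inA: "z [^] b \<otimes> h [^] a \<in> A" for a b :: nat
      using hzA subgroup_int_pow_closed[OF A] subgroup.m_closed[OF A] by (metis int_pow_int)
    have coset: "A #> m (a, b, g) = A #> g" if g: "g \<in> carrier G" for a b g
    proof -
      define y where "y = z [^] b \<otimes> h [^] a"
      have y: "y \<in> A" "y \<in> carrier G" using inA hG z by (simp_all add: y_def)
      have "A #> (y \<otimes> g) = (A #> y) #> g"
        using coset_mult_assoc[OF subgroup.subset[OF A] y(2) g] by simp
      also have "A #> y = A" by (rule coset_join2[OF y(2) A y(1)])
      finally show ?thesis by (simp only: m[OF g] y_def)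
    qed
    have "A #> g = A #> m (a, b, g)" using coset[OF gG(1)] by simp
    also have "\<dots> = A #> g'" unfolding eq by (rule coset[OF gG(2)])
    finally have "A #> g = A #> g'" .
    then have gg: "g = g'" using R(2) g by (meson inj_onD)
    then have "z [^] b \<otimes> h [^] a = z [^] b' \<otimes> h [^] a'"
      using eq m gG z hG by simp
    then have eq': "h [^] int a \<otimes> z [^] int b = h [^] int a' \<otimes> z [^] int b'"
      using zc[of "h [^] a" b] zc[of "h [^] a'" b'] hG by (simp add: int_pow_int)
    have "h [^] (- p) \<otimes> (h [^] r \<otimes> z [^] s) \<otimes> z [^] (- t) = h [^] (r - p) \<otimes> z [^] (s - t)"
      for p r s t :: int
    proof -
      have "h [^] (- p) \<otimes> (h [^] r \<otimes> z [^] s) \<otimes> z [^] (- t)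
          = (h [^] (- p) \<otimes> h [^] r) \<otimes> (z [^] s \<otimes> z [^] (- t))"
        using hG z by (simp add: m_assoc)
      also have "\<dots> = h [^] (r - p) \<otimes> z [^] (s - t)"
        using hG z by (simp flip: int_pow_mult)
      finally show ?thesis .
    qed
    from this[of "int a'" "int a" "int b" "int b"] this[of "int a'" "int a'" "int b'" "int b"]
    have "h [^] (int a - int a') = z [^] (int b' - int b)"
      using hG z by (simp add: eq')
    from indep[OF this] show "a = a' \<and> b = b' \<and> g = g'" using gg by simp
  qed
  have "inj_on m ({..n} \<times> {..<N} \<times> R)"
  proof (rule inj_onI)
    fix x y assume xy: "x \<in> {..n} \<times> {..<N} \<times> R" "y \<in> {..n} \<times> {..<N} \<times> R" "m x = m y"
    obtain a b g a' b' g' where "x = (a, b, g)" "y = (a', b', g')" using prod_cases3 by metis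
    then show "x = y" using xy m_inj[of g g' a b a' b'] by simp
  qed
  moreover have "m ` ({..n} \<times> {..<N} \<times> R) \<subseteq> F"
  proof
    fix x assume "x \<in> m ` ({..n} \<times> {..<N} \<times> R)"
    then obtain a b g where *: "a \<in> {..n}" "b \<in> {..<N}" "g \<in> R" and x: "x = m (a, b, g)"
      by auto
    have "h [^] a \<otimes> g \<in> word_ball G S (a * l + n)"
      using word_ball_mult[OF S pow_ball] R(1) * by blast
    moreover have "a * l + n \<le> N"
    proof -
      have "a * l + n \<le> n * (l + 1)" using * by simp
      also have "\<dots> \<le> N" unfolding n_def by (rule div_times_less_eq_dividend)
      finally show ?thesis .
    qed
    ultimately have "h [^] a \<otimes> g \<in> word_ball G S N"
      using word_ball_mono[of "a * l + n" N G S] by blast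
    then show "x \<in> F" using * x by (auto simp: F_def m_def)
  qed
  ultimately have "card ({..n} \<times> {..<N} \<times> R) \<le> card F"
    using finF card_inj_on_le by blast
  then have "(n + 1) * (N * card R) \<le> card F" by (simp add: card_cartesian_product)
  moreover have "(n + 1) * (N * (n + 1)) \<le> (n + 1) * (N * card R)"
    using cardR by (intro mult_le_mono) auto
  ultimately have cF: "N * (n + 1)\<^sup>2 \<le> card F" by (simp add: power2_eq_square algebra_simps)
  have "N \<le> (l + 1) * (n + 1)"
    unfolding n_def using dividend_less_times_div[of "l + 1" N] by (simp add: algebra_simps)
  then have "N\<^sup>2 \<le> (l + 1)\<^sup>2 * (n + 1)\<^sup>2" by (metis power_mono power_mult_distrib zero_le)
  then have "N * N\<^sup>2 \<le> N * ((l + 1)\<^sup>2 * (n + 1)\<^sup>2)" by simp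
  also have "\<dots> = (l + 1)\<^sup>2 * (N * (n + 1)\<^sup>2)" by (simp only: ac_simps)
  also have "\<dots> \<le> (l + 1)\<^sup>2 * card F" using cF by (rule mult_le_mono2)
  finally show ?thesis by (simp add: F_def power3_eq_cube power2_eq_square)
qed

lemma word_value_hom:
  assumes "group G'" "q \<in> hom G G'" "set w \<subseteq> carrier G"
  shows "word_value G' (map q w) = q (word_value G w)"
  using assms(3)
proof (induction w)
  case Nil
  then show ?case using hom_one[OF assms(2) is_group assms(1)] by (simp add: word_value_def)
next
  case (Cons a w)
  then show ?case using hom_mult[OF assms(2)] word_value_closed[of w] by (simp add: word_value_def)
qed

lemma word_ball_hom:
  assumes "group G'" "q \<in> hom G G'" "S \<subseteq> carrier G"
  shows "word_ball G' (q ` S) n = q ` word_ball G S n"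
proof -
  have words: "{w. set w \<subseteq> q ` S \<and> length w \<le> n} = map q ` {w. set w \<subseteq> S \<and> length w \<le> n}"
  proof
    show "{w. set w \<subseteq> q ` S \<and> length w \<le> n} \<subseteq> map q ` {w. set w \<subseteq> S \<and> length w \<le> n}"
    proof
      fix w assume w: "w \<in> {w. set w \<subseteq> q ` S \<and> length w \<le> n}"
      then have "w \<in> lists (q ` S)" by (simp add: lists_eq_set)
      then obtain v where "v \<in> lists S" "w = map q v" unfolding lists_image by blast
      then show "w \<in> map q ` {w. set w \<subseteq> S \<and> length w \<le> n}"
        using w by (simp add: lists_eq_set)
    qed
  qed (auto simp: subset_iff)
  have "word_value G' (map q w) = q (word_value G w)" if "set w \<subseteq> S" for w
    using word_value_hom[OF assms(1,2)] that assms(3) by blast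
  then show ?thesis
    unfolding word_ball_def words image_image by (intro image_cong) auto
qed

text \<open>
  Dividing by the central subgroup \<open>\<langle>z\<rangle>\<close> lowers the growth by one degree, so some ball of
  radius \<open>n\<close> in the image of \<open>H\<close> has at most \<open>n\<^sup>2 / 2\<close> elements. If the image is finite, \<open>H \<inter> \<langle>z\<rangle>\<close> has finite index in \<open>H\<close>. If it is
  infinite, it contains an element of infinite order, the image of some \<open>h\<close>; then \<open>\<langle>h, z\<rangle>\<close>
  is free abelian of rank two, and it has finite index because the growth is less than cubic.
\<close>

theorem virtually_abelian_if_subcubic_growth:
  assumes H: "subgroup H G" and fin: "finite S" and S: "S \<subseteq> carrier G"
    and H_eq: "H = (\<Union>n. word_ball G S n)"
    and z: "z \<in> carrier G" and central: "\<And>g. g \<in> carrier G \<Longrightarrow> z \<otimes> g = g \<otimes> z"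
    and inf_order: "\<And>k::nat. k > 0 \<Longrightarrow> z [^] k \<noteq> \<one>"
    and growth: "\<And>\<epsilon>::real. \<epsilon> > 0 \<Longrightarrow> \<exists>n\<ge>1.
      real (card {g \<otimes> z [^] i | g (i::nat). g \<in> word_ball G S n \<and> i < n}) \<le> \<epsilon> * real n ^ 3"
  shows "virtually_abelian_group (G\<lparr>carrier := H\<rparr>)"
proof -
  define Z where "Z = generate G {z}"
  have Z: "subgroup Z G" using z generate_is_subgroup[of "{z}"] by (simp add: Z_def)
  have Z_eq: "Z = {z [^] (k::int) | k. True}" using generate_pow[OF z] by (simp add: Z_def)
  have zc: "z [^] k \<otimes> g = g \<otimes> z [^] k" if "g \<in> carrier G" for g and k :: int
    using int_pow_commute[OF z that central[OF that]] .
  have "Z \<lhd> G"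
    unfolding normal_inv_iff
  proof (intro conjI ballI)
    fix g x assume g: "g \<in> carrier G" and "x \<in> Z"
    then obtain k :: int where "x = z [^] k" by (auto simp: Z_eq)
    then have "g \<otimes> x \<otimes> inv g = x \<otimes> g \<otimes> inv g" using zc[OF g, of k] by simp
    also have "\<dots> = x" using g z \<open>x = z [^] k\<close> by (simp add: m_assoc)
    finally have "g \<otimes> x \<otimes> inv g = x" .
    then show "g \<otimes> x \<otimes> inv g \<in> Z" using \<open>x \<in> Z\<close> by simp
  qed (rule Z)
  then interpret Z: normal Z G .
  interpret Q: group "G Mod Z" by (rule Z.factorgroup_is_group)
  define q where "q = (\<lambda>g. Z #> g)"
  have hom: "q \<in> hom G (G Mod Z)" using Z.r_coset_hom_Mod by (simp add: q_def)
  have qS: "q ` S \<subseteq> carrier (G Mod Z)" using S hom by (auto simp: hom_def)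
  have ballQ: "word_ball (G Mod Z) (q ` S) n = q ` word_ball G S n" for n
    by (rule word_ball_hom[OF Q.is_group hom S])
  have BG: "g \<in> carrier G" if "g \<in> word_ball G S n" for g n
    using word_ball_closed[OF S] that by blast
  define F where "F n = {g \<otimes> z [^] i | g (i::nat). g \<in> word_ball G S n \<and> i < n}" for n
  have finF: "finite (F n)" for n
  proof -
    have "F n = (\<lambda>(g, i). g \<otimes> z [^] i) ` (word_ball G S n \<times> {..<n})" by (auto simp: F_def)
    then show ?thesis by (simp add: finite_word_ball[OF fin])
  qed
  have cardF: "n * card (q ` word_ball G S n) \<le> card (F n)" for n
  proof -
    obtain R where R: "R \<subseteq> word_ball G S n" "inj_on q R" "q ` word_ball G S n = q ` R"
      using subset_image_inj[of "q ` word_ball G S n" q "word_ball G S n"] by auto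
    define m where "m = (\<lambda>(g, i::nat). g \<otimes> z [^] i)"
    have "inj_on m (R \<times> {..<n})"
    proof (rule inj_onI, clarify)
      fix g g' i i' assume g: "g \<in> R" "g' \<in> R" and eq: "m (g, i) = m (g', i')"
      have gG: "g \<in> carrier G" "g' \<in> carrier G" using g R(1) BG by blast+
      have "q g = q (m (g, i))" if "g \<in> carrier G" for g i
      proof -
        have zi: "z [^] i \<in> Z" unfolding Z_eq using int_pow_int[of G z i] by (metis (mono_tags) mem_Collect_eq)
        have "m (g, i) = z [^] i \<otimes> g"
          using zc[OF that, of "int i"] by (simp add: m_def int_pow_int)
        then show ?thesis unfolding q_def
          using that z Z zi coset_mult_assoc[of Z "z [^] i" g] coset_join2[of "z [^] i" Z]
          by (simp add: subgroup.subset)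
      qed
      then have gg: "g = g'" using gG eq inj_onD[OF R(2) _ g] by metis
      then have "z [^] int i = z [^] int i'"
        using eq gG z by (simp add: m_def int_pow_int)
      then have "z [^] (int i - int i') = \<one>" using z by (simp add: int_pow_diff)
      then have "i = i'" using int_pow_neq_one[OF z inf_order] by fastforce
      then show "g = g' \<and> i = i'" using gg by simp
    qed
    moreover have "m ` (R \<times> {..<n}) \<subseteq> F n" using R(1) by (auto simp: F_def m_def)
    ultimately have "card (R \<times> {..<n}) \<le> card (F n)" using finF card_inj_on_le by blast
    then show ?thesis using card_image[OF R(2)] R(3)
      by (simp add: card_cartesian_product mult.commute)
  qed
  show ?thesis
  proof (cases "finite (q ` H)")
    case True
    show ?thesis
    proof (rule virtually_abelian_if_finitely_many_cosets[OF H Z])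
      show "finite ((\<lambda>g. Z #> g) ` H)" using True by (simp add: q_def)
      show "a \<otimes> b = b \<otimes> a" if "a \<in> Z" "b \<in> Z" for a b
        using that zc z by (auto simp: Z_eq)
    qed
  next
    case False
    then have inf: "infinite (\<Union>n. word_ball (G Mod Z) (q ` S) n)"
      by (simp add: H_eq ballQ image_UN)
    obtain n where n: "n \<ge> 1" "real (card (F n)) \<le> 1/2 * real n ^ 3"
      using growth[of "1/2"] by (auto simp: F_def)
    have "real (2 * card (F n)) \<le> real (n ^ 3)" using n by simp
    then have "2 * (n * card (q ` word_ball G S n)) \<le> n ^ 3"
      using cardF[of n] unfolding of_nat_le_iff by linarith
    then have "n * (2 * card (q ` word_ball G S n)) \<le> n * n ^ 2"
      by (simp add: power3_eq_cube power2_eq_square mult.left_commute mult.assoc)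
    then have few: "2 * card (word_ball (G Mod Z) (q ` S) n) \<le> n ^ 2"
      using n(1) unfolding ballQ by simp
    obtain l h where h: "h \<in> word_ball G S l" and qh: "\<And>k::nat. k > 0 \<Longrightarrow> q h [^]\<^bsub>G Mod Z\<^esub> k \<noteq> Z"
      using Q.infinite_order_element_if_few_elements_in_ball[OF finite_imageI[OF fin] qS inf few]
      unfolding ballQ by auto
    have hG: "h \<in> carrier G" using h BG by blast
    have h_pow: "h [^] k \<notin> Z" if "k > 0" for k :: nat
    proof
      assume "h [^] k \<in> Z"
      then have "q (h [^] k) = Z" using coset_join2[OF _ Z] hG by (simp add: q_def)
      then show False using qh[OF that] Z.FactGroup_pow[OF hG, of k] by (simp add: q_def)
    qed
    have indep: "a = 0 \<and> b = 0" if eq: "h [^] a = z [^] b" for a b :: int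
    proof -
      have "h [^] \<bar>a\<bar> \<in> Z"
      proof (cases "a < 0")
        case True
        then have "h [^] \<bar>a\<bar> = z [^] (- b)" using eq hG z by (simp add: int_pow_neg)
        then show ?thesis by (auto simp: Z_eq)
      next
        case False
        then have "h [^] \<bar>a\<bar> = z [^] b" using eq by simp
        then show ?thesis by (auto simp: Z_eq)
      qed
      then have "h [^] nat \<bar>a\<bar> \<in> Z" by (metis abs_ge_zero int_pow_int nat_0_le)
      then have "a = 0" using h_pow[of "nat \<bar>a\<bar>"] by fastforce
      then show ?thesis using eq int_pow_neq_one[OF z inf_order] by simp
    qed
    define A where "A = {h [^] a \<otimes> z [^] b | (a::int) (b::int). True}"
    have mult: "(h [^] a \<otimes> z [^] b) \<otimes> (h [^] c \<otimes> z [^] d) = h [^] (a + c) \<otimes> z [^] (b + d)"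
      for a b c d :: int
    proof -
      have "(h [^] a \<otimes> z [^] b) \<otimes> (h [^] c \<otimes> z [^] d)
          = h [^] a \<otimes> (z [^] b \<otimes> h [^] c) \<otimes> z [^] d"
        using hG z by (simp add: m_assoc)
      also have "\<dots> = h [^] a \<otimes> (h [^] c \<otimes> z [^] b) \<otimes> z [^] d"
        using zc[of "h [^] c" b] hG by simp
      also have "\<dots> = h [^] (a + c) \<otimes> z [^] (b + d)"
        using hG z by (simp add: m_assoc int_pow_mult)
      finally show ?thesis .
    qed
    have A: "subgroup A G"
    proof (rule subgroupI)
      show "A \<subseteq> carrier G" using hG z by (auto simp: A_def)
      show "A \<noteq> {}" by (auto simp: A_def)
      fix x assume "x \<in> A"
      then obtain a b :: int where ab: "x = h [^] a \<otimes> z [^] b" by (auto simp: A_def)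
      have "(h [^] (- a) \<otimes> z [^] (- b)) \<otimes> x = \<one>" using mult[of "- a" "- b" a b] ab by simp
      then have "inv x = h [^] (- a) \<otimes> z [^] (- b)"
        using ab hG z by (intro inv_equality) auto
      then show "inv x \<in> A" by (auto simp: A_def)
      fix y assume "y \<in> A"
      then obtain c d :: int where "y = h [^] c \<otimes> z [^] d" by (auto simp: A_def)
      then show "x \<otimes> y \<in> A" using ab mult by (auto simp: A_def)
    qed
    have comm: "x \<otimes> y = y \<otimes> x" if xy: "x \<in> A" "y \<in> A" for x y
    proof -
      obtain a b c d :: int where "x = h [^] a \<otimes> z [^] b" "y = h [^] c \<otimes> z [^] d"
        using xy by (auto simp: A_def)
      then show ?thesis using mult by (simp add: add.commute)
    qed
    have "h [^] (1::int) \<otimes> z [^] (0::int) \<in> A" "h [^] (0::int) \<otimes> z [^] (1::int) \<in> A"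
      unfolding A_def by blast+
    then have hzA: "h \<in> A" "z \<in> A" using hG z by simp_all
    have "finite ((\<lambda>g. A #> g) ` H)"
    proof (rule ccontr)
      assume "infinite ((\<lambda>g. A #> g) ` H)"
      then have cubic: "N ^ 3 \<le> (l + 1)\<^sup>2 * card (F N)" for N
        unfolding F_def H_eq
        using cubic_growth_if_infinitely_many_cosets[OF fin S z central indep h A hzA] by blast
      define \<epsilon> where "\<epsilon> = 1 / (2 * (real l + 1)\<^sup>2)"
      have "\<epsilon> > 0" by (simp add: \<epsilon>_def add_nonneg_pos)
      then obtain N where N: "N \<ge> 1" "real (card (F N)) \<le> \<epsilon> * real N ^ 3"
        using growth[of \<epsilon>] unfolding F_def by blast
      have pos: "(real l + 1)\<^sup>2 > 0" by (simp add: add_nonneg_pos)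
      have "real N ^ 3 \<le> (real l + 1)\<^sup>2 * real (card (F N))"
        using cubic[of N, folded of_nat_le_iff[where 'a = real]] by (simp add: add.commute)
      also have "\<dots> \<le> (real l + 1)\<^sup>2 * (\<epsilon> * real N ^ 3)"
        using N(2) pos by (intro mult_left_mono) auto
      also have "\<dots> = real N ^ 3 / 2" using pos by (simp add: \<epsilon>_def)
      finally show False using N(1) by simp
    qed
    then show ?thesis by (intro virtually_abelian_if_finitely_many_cosets[OF H A comm])
  qed
qed

end

section \<open>Functions of cubic growth do not double at every scale\<close>

text \<open>
  If \<open>P (24 r) \<ge> 2 P (20 r)\<close> for all large \<open>r\<close>, then \<open>P\<close> grows at least like \<open>n ^ c\<close> with
  \<open>c = log 2 / log (6/5)\<close>, and \<open>c > 3\<close> since \<open>(6/5)\<^sup>3 = 216/125 < 2\<close>.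
\<close>

lemma not_doubling_infinitely_often:
  fixes P :: "nat \<Rightarrow> nat"
  assumes mono: "\<And>m n. m \<le> n \<Longrightarrow> P m \<le> P n" and pos: "\<And>n. P n > 0"
    and cubic: "\<And>n. n \<ge> N0 \<Longrightarrow> real (P n) \<le> real n ^ 3"
  shows "\<exists>r\<ge>M. P (24 * r) < 2 * P (20 * r)"
proof (rule ccontr)
  assume "\<not> ?thesis"
  then have double: "2 * P (20 * r) \<le> P (24 * r)" if "r \<ge> M" for r using that by (simp add: not_less)
  define \<rho> where "\<rho> i = ((\<lambda>r. (6 * r + 4) div 5) ^^ i) (max M N0)" for i
  have \<rho>_Suc: "\<rho> (Suc i) = (6 * \<rho> i + 4) div 5" for i by (simp add: \<rho>_def)
  have \<rho>_ge: "\<rho> i \<ge> max M N0" for i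
  proof (induction i)
    case 0
    then show ?case by (simp add: \<rho>_def)
  next
    case (Suc i)
    have "\<rho> i \<le> \<rho> (Suc i)" unfolding \<rho>_Suc by linarith
    then show ?case using Suc by linarith
  qed
  have lower: "2 ^ i \<le> P (20 * \<rho> i)" for i
  proof (induction i)
    case 0
    then show ?case using pos[of "20 * \<rho> 0"] by simp
  next
    case (Suc i)
    have "2 ^ Suc i \<le> 2 * P (20 * \<rho> i)" using Suc by simp
    also have "\<dots> \<le> P (24 * \<rho> i)" by (rule double) (use \<rho>_ge[of i] in simp)
    also have "\<dots> \<le> P (20 * \<rho> (Suc i))" by (rule mono) (unfold \<rho>_Suc, linarith)
    finally show ?case .
  qed
  have upper: "real (\<rho> i) + 4 \<le> (6/5) ^ i * (real (\<rho> 0) + 4)" for i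
  proof (induction i)
    case (Suc i)
    have "5 * \<rho> (Suc i) \<le> 6 * \<rho> i + 4" unfolding \<rho>_Suc by linarith
    then have "real (5 * \<rho> (Suc i)) \<le> real (6 * \<rho> i + 4)" by (rule of_nat_mono)
    then have "real (\<rho> (Suc i)) + 4 \<le> 6/5 * (real (\<rho> i) + 4)" by simp
    also have "\<dots> \<le> 6/5 * ((6/5) ^ i * (real (\<rho> 0) + 4))" using Suc by simp
    finally show ?case by simp
  qed simp
  define K where "K = (20 * (real (\<rho> 0) + 4)) ^ 3"
  have "(250/216) ^ i \<le> K" for i
  proof -
    have "2 ^ i \<le> real (P (20 * \<rho> i))"
      using of_nat_mono[OF lower[of i], where 'a = real] by simp
    also have "\<dots> \<le> real (20 * \<rho> i) ^ 3"
      by (rule cubic) (use \<rho>_ge[of i] in linarith)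
    also have "\<dots> \<le> (20 * ((6/5) ^ i * (real (\<rho> 0) + 4))) ^ 3"
      by (rule power_mono) (use upper[of i] in linarith, simp)
    also have "\<dots> = K * (216/125) ^ i"
    proof -
      have "((6/5) ^ i) ^ 3 = (216/125 :: real) ^ i"
        by (simp add: power_mult[symmetric] mult.commute[of i]) (simp add: power_mult power3_eq_cube)
      then show ?thesis unfolding K_def power_mult_distrib by (simp only: mult_ac)
    qed
    finally have "2 ^ i / (216/125) ^ i \<le> K" by (simp add: divide_le_eq)
    moreover have "2 ^ i / (216/125) ^ i = (250/216 :: real) ^ i"
      by (simp flip: power_divide)
    ultimately show ?thesis by simp
  qed
  moreover obtain i where "K < (250/216) ^ i" using real_arch_pow[of "250/216" K] by auto
  ultimately show False by (meson not_le)
qed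

section \<open>Automorphisms of a minimal subshift as sliding block codes\<close>

definition translate :: "int \<Rightarrow> (int \<Rightarrow> 'a) \<Rightarrow> int \<Rightarrow> 'a"
  where "translate n x = (\<lambda>i. x (i + n))"

definition agree :: "int \<Rightarrow> int \<Rightarrow> (int \<Rightarrow> 'a) \<Rightarrow> (int \<Rightarrow> 'a) \<Rightarrow> bool"
  where "agree a b x y \<longleftrightarrow> (\<forall>i. a \<le> i \<longrightarrow> i < b \<longrightarrow> x i = y i)"

lemma translate_apply [simp]: "translate n x i = x (i + n)"
  by (simp add: translate_def)

lemma translate_0 [simp]: "translate 0 x = x"
  by (simp add: translate_def)

lemma translate_translate [simp]: "translate m (translate n x) = translate (m + n) x"
  by (simp add: translate_def algebra_simps)

lemma shift_eq_translate: "shift = translate 1"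
  by (simp add: shift_def translate_def fun_eq_iff)

lemma agree_refl [simp]: "agree a b x x"
  by (simp add: agree_def)

lemma agree_sym: "agree a b x y \<Longrightarrow> agree a b y x"
  by (simp add: agree_def)

lemma agree_trans: "agree a b x y \<Longrightarrow> agree a b y z \<Longrightarrow> agree a b x z"
  by (simp add: agree_def)

lemma agree_mono: "agree a b x y \<Longrightarrow> a \<le> a' \<Longrightarrow> b' \<le> b \<Longrightarrow> agree a' b' x y"
  by (simp add: agree_def)

lemma agree_translate: "agree a b (translate n x) (translate n y) \<longleftrightarrow> agree (a + n) (b + n) x y"
proof
  assume *: "agree a b (translate n x) (translate n y)"
  show "agree (a + n) (b + n) x y"
    unfolding agree_def
  proof (intro allI impI)
    fix i assume "a + n \<le> i" "i < b + n"
    then show "x i = y i" using *[unfolded agree_def, rule_format, of "i - n"] by simp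
  qed
qed (simp add: agree_def)

locale minimal_shift =
  fixes A :: "'a set" and X :: "(int \<Rightarrow> 'a) set"
  assumes minimal: "minimal_subshift A X"
begin

abbreviation T where "T \<equiv> subshift_topology A X"

lemma sub: "subshift A X"
  using minimal by (simp add: minimal_subshift_def)

lemma topspace_T [simp]: "topspace T = X"
  using sub by (rule topspace_subshift)

lemma finite_alphabet: "finite A"
  using sub by (simp add: subshift_def)

lemma in_alphabet: "x \<in> X \<Longrightarrow> x i \<in> A"
  using closedin_subset[of "full_shift A" X] sub
  by (auto simp: subshift_def full_shift_def PiE_iff)

lemma translate_in: "x \<in> X \<Longrightarrow> translate n x \<in> X"
proof -
  have img: "translate 1 ` X = X" using sub by (simp add: subshift_def shift_eq_translate)
  have pos: "translate (int m) x \<in> X" if "x \<in> X" for m x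
  proof (induction m)
    case (Suc m)
    then have "translate 1 (translate (int m) x) \<in> X" using img by blast
    moreover have "translate 1 (translate (int m) x) = translate (int (Suc m)) x"
      by (simp only: translate_translate of_nat_Suc)
    ultimately show ?case by (simp only:)
  qed (use that in simp)
  have neg: "translate (- int m) x \<in> X" if "x \<in> X" for m x
  proof (induction m)
    case (Suc m)
    then obtain y where y: "y \<in> X" "translate (- int m) x = translate 1 y" using img by blast
    have "translate (- int (Suc m)) x = translate (- 1) (translate (- int m) x)" by simp
    also have "\<dots> = y" by (simp add: y)
    finally show ?case using y by simp
  qed (use that in simp)
  assume "x \<in> X"
  then show ?thesis using pos neg by (cases n rule: int_cases2) auto
qed

lemma openin_cylinder:
  assumes "finite J"
  shows "openin T {y \<in> X. \<forall>j\<in>J. y j = x j}"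
  using assms
proof induction
  case empty
  have "openin T X" using openin_topspace[of T] unfolding topspace_T .
  then show ?case by simp
next
  case (insert j J)
  have "continuous_map (full_shift A) (discrete_topology A) (\<lambda>y. y j)"
    unfolding full_shift_def by (rule continuous_map_product_projection) simp
  then have "openin (full_shift A) {y \<in> topspace (full_shift A). y j \<in> {x j} \<inter> A}"
    by (rule openin_continuous_map_preimage) simp
  then have "openin T (X \<inter> {y \<in> topspace (full_shift A). y j \<in> {x j} \<inter> A})"
    by (rule openin_subtopology_Int2)
  moreover have "X \<subseteq> topspace (full_shift A)"
    using sub closedin_subset by (auto simp: subshift_def)
  then have "X \<inter> {y \<in> topspace (full_shift A). y j \<in> {x j} \<inter> A} = {y \<in> X. y j = x j}"
    using in_alphabet by auto
  ultimately have "openin T {y \<in> X. y j = x j}" by (simp only:)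
  then have "openin T ({y \<in> X. y j = x j} \<inter> {y \<in> X. \<forall>j\<in>J. y j = x j})"
    using insert.IH by (rule openin_Int)
  then show ?case by (rule back_subst[of "openin T"]) auto
qed

lemma open_contains_cylinder:
  assumes V: "openin T V" and x: "x \<in> V"
  shows "\<exists>n::nat. \<forall>y\<in>X. agree (- int n) (int n + 1) x y \<longrightarrow> y \<in> V"
proof -
  obtain U where U: "openin (full_shift A) U" "V = U \<inter> X"
    using V by (auto simp: openin_subtopology)
  then obtain W where fin: "finite {i. W i \<noteq> A}" and W: "x \<in> Pi\<^sub>E UNIV W" "Pi\<^sub>E UNIV W \<subseteq> U"
    using x unfolding full_shift_def openin_product_topology_alt by force
  define n where "n = nat (Max (insert 0 (abs ` {i. W i \<noteq> A})))"
  have n: "\<bar>i\<bar> \<le> int n" if "W i \<noteq> A" for i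
    unfolding n_def using fin that by (auto simp: Max_ge_iff intro!: Max_ge)
  have "y \<in> V" if y: "y \<in> X" "agree (- int n) (int n + 1) x y" for y
  proof -
    have "y i \<in> W i" for i
    proof (cases "W i = A")
      case False
      then have "y i = x i" using n[of i] y(2) by (simp add: agree_def abs_le_iff)
      then show ?thesis using W(1) by (simp add: PiE_iff)
    qed (use y in_alphabet in simp)
    then show ?thesis using W(2) U(2) y(1) by (auto simp: PiE_iff)
  qed
  then show ?thesis by blast
qed

text \<open>
  Compactness in the form used below: an increasing exhaustion of \<open>X\<close> by sets, each of which is
  described by a finite window and therefore open, is finite.
\<close>

lemma exhaustion_terminates:
  fixes U :: "nat \<Rightarrow> (int \<Rightarrow> 'a) set"
  assumes sub: "\<And>n. U n \<subseteq> X" and mono: "\<And>m n. m \<le> n \<Longrightarrow> U m \<subseteq> U n"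
    and window: "\<And>n. \<exists>m::nat. \<forall>x\<in>U n. \<forall>y\<in>X. agree (- int m) (int m + 1) x y \<longrightarrow> y \<in> U n"
    and cover: "X \<subseteq> (\<Union>n. U n)"
  shows "\<exists>n. X \<subseteq> U n"
proof -
  have "compact_space (full_shift A)"
    using finite_alphabet by (simp add: full_shift_def compact_space_product_topology
        compact_space_discrete_topology)
  then have "compactin (full_shift A) X"
    using closedin_compact_space minimal unfolding minimal_subshift_def subshift_def by blast
  then have comp: "compactin T X" by (simp add: compactin_subtopology)
  have "openin T (U n)" for n
  proof -
    obtain m :: nat where m: "\<forall>x\<in>U n. \<forall>y\<in>X. agree (- int m) (int m + 1) x y \<longrightarrow> y \<in> U n"
      using window by blast
    define J where "J = {- int m..int m}"
    have "U n = (\<Union>x\<in>U n. {y \<in> X. \<forall>j\<in>J. y j = x j})"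
    proof
      show "(\<Union>x\<in>U n. {y \<in> X. \<forall>j\<in>J. y j = x j}) \<subseteq> U n"
      proof clarify
        fix x y assume "x \<in> U n" "y \<in> X" "\<forall>j\<in>J. y j = x j"
        then show "y \<in> U n" using m by (simp add: J_def agree_def)
      qed
    qed (use sub in auto)
    moreover have "openin T (\<Union>x\<in>U n. {y \<in> X. \<forall>j\<in>J. y j = x j})"
      by (rule openin_Union) (auto simp: J_def intro: openin_cylinder)
    ultimately show ?thesis by simp
  qed
  then obtain \<F> where F: "finite \<F>" "\<F> \<subseteq> range U" "X \<subseteq> \<Union>\<F>"
    using compactinD[OF comp, of "range U"] cover by auto
  then obtain I where I: "finite I" "\<F> = U ` I" by (meson finite_subset_image)
  have "X \<subseteq> U (Max (insert 0 I))"
  proof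
    fix x assume "x \<in> X"
    then obtain i where "i \<in> I" "x \<in> U i" using F(3) I(2) by auto
    then show "x \<in> U (Max (insert 0 I))" using mono[of i "Max (insert 0 I)"] I(1) by auto
  qed
  then show ?thesis ..
qed

text \<open>
  By minimality the finite pattern occurs in every point, and by compactness within bounded
  distance of the origin.
\<close>

lemma syndetic:
  assumes x0: "x0 \<in> X"
  shows "\<exists>N::nat. \<forall>x\<in>X. \<exists>p. \<bar>p\<bar> \<le> int N \<and> agree a b (translate p x) x0"
proof -
  define U where "U N = {x \<in> X. \<exists>p. \<bar>p\<bar> \<le> int N \<and> agree a b (translate p x) x0}" for N :: nat
  have "\<exists>N. X \<subseteq> U N"
  proof (rule exhaustion_terminates)
    show "U n \<subseteq> X" for n by (auto simp: U_def)
    show "U m \<subseteq> U n" if "m \<le> n" for m n using that by (force simp: U_def)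
    show "\<exists>m::nat. \<forall>x\<in>U n. \<forall>y\<in>X. agree (- int m) (int m + 1) x y \<longrightarrow> y \<in> U n" for n
    proof (intro exI ballI impI)
      fix x y assume x: "x \<in> U n" and y: "y \<in> X"
        and xy: "agree (- int (nat (\<bar>a\<bar> + \<bar>b\<bar>) + n)) (int (nat (\<bar>a\<bar> + \<bar>b\<bar>) + n) + 1) x y"
      obtain p where p: "\<bar>p\<bar> \<le> int n" "agree a b (translate p x) x0"
        using x by (auto simp: U_def)
      have "agree a b (translate p x) (translate p y)"
        unfolding agree_translate by (rule agree_mono[OF xy]) (use p(1) in auto)
      then have "agree a b (translate p y) x0" using p(2) agree_sym agree_trans by metis
      then show "y \<in> U n" using p(1) y by (auto simp: U_def)
    qed
    show "X \<subseteq> (\<Union>n. U n)"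
    proof
      fix x assume x: "x \<in> X"
      have "x0 \<in> T closure_of shift_orbit x"
        using minimal x x0 by (auto simp: minimal_subshift_def)
      moreover have "openin T {y \<in> X. \<forall>j\<in>{a..<b}. y j = x0 j}"
        by (rule openin_cylinder) simp
      moreover have "x0 \<in> {y \<in> X. \<forall>j\<in>{a..<b}. y j = x0 j}" using x0 by simp
      ultimately obtain y where "y \<in> shift_orbit x" "y \<in> {y \<in> X. \<forall>j\<in>{a..<b}. y j = x0 j}"
        unfolding in_closure_of by meson
      then have y: "y \<in> shift_orbit x" "\<forall>j\<in>{a..<b}. y j = x0 j" by simp_all
      then obtain p where "y = translate p x" by (auto simp: shift_orbit_def translate_def)
      then have "x \<in> U (nat \<bar>p\<bar>)" using x y(2) by (auto simp: U_def agree_def)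
      then show "x \<in> (\<Union>n. U n)" by blast
    qed
  qed
  then show ?thesis by (auto simp: U_def)
qed

section \<open>The group of automorphisms\<close>

abbreviation G where "G \<equiv> Aut A X"

sublocale G: group G
  by (rule group_Aut[OF sub])

lemma Aut_Bij: "\<phi> \<in> carrier G \<Longrightarrow> \<phi> \<in> Bij X"
  by (simp add: Aut_def)

lemma Aut_bij_betw: "\<phi> \<in> carrier G \<Longrightarrow> bij_betw \<phi> X X"
  using Aut_Bij by (simp add: Bij_def)

lemma Aut_in [simp]: "\<phi> \<in> carrier G \<Longrightarrow> x \<in> X \<Longrightarrow> \<phi> x \<in> X"
  using Aut_bij_betw bij_betwE by blast

lemma Aut_mult [simp]:
  "\<phi> \<in> carrier G \<Longrightarrow> \<psi> \<in> carrier G \<Longrightarrow> x \<in> X \<Longrightarrow> (\<phi> \<otimes>\<^bsub>G\<^esub> \<psi>) x = \<phi> (\<psi> x)"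
  using Aut_Bij[of \<phi>] Aut_Bij[of \<psi>] by (simp add: Aut_def BijGroup_def compose_eq)

lemma Aut_one [simp]: "x \<in> X \<Longrightarrow> \<one>\<^bsub>G\<^esub> x = x"
  by (simp add: Aut_def BijGroup_def)

lemma Aut_eqI:
  "\<phi> \<in> carrier G \<Longrightarrow> \<psi> \<in> carrier G \<Longrightarrow> (\<And>x. x \<in> X \<Longrightarrow> \<phi> x = \<psi> x) \<Longrightarrow> \<phi> = \<psi>"
  by (rule extensionalityI[of \<phi> X \<psi>]) (simp_all add: Aut_Bij Bij_imp_extensional)

lemma Aut_inv_apply [simp]:
  assumes "\<phi> \<in> carrier G" "x \<in> X"
  shows "(inv\<^bsub>G\<^esub> \<phi>) (\<phi> x) = x" "\<phi> ((inv\<^bsub>G\<^esub> \<phi>) x) = x"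
proof -
  have "(inv\<^bsub>G\<^esub> \<phi>) (\<phi> x) = (inv\<^bsub>G\<^esub> \<phi> \<otimes>\<^bsub>G\<^esub> \<phi>) x"
    by (simp only: Aut_mult assms G.inv_closed)
  also have "\<dots> = x" by (simp only: G.l_inv Aut_one assms)
  finally show "(inv\<^bsub>G\<^esub> \<phi>) (\<phi> x) = x" .
  have "\<phi> ((inv\<^bsub>G\<^esub> \<phi>) x) = (\<phi> \<otimes>\<^bsub>G\<^esub> inv\<^bsub>G\<^esub> \<phi>) x"
    by (simp only: Aut_mult assms G.inv_closed)
  also have "\<dots> = x" by (simp only: G.r_inv Aut_one assms)
  finally show "\<phi> ((inv\<^bsub>G\<^esub> \<phi>) x) = x" .
qed

lemma Aut_translate:
  assumes \<phi>: "\<phi> \<in> carrier G" and "x \<in> X"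
  shows "\<phi> (translate n x) = translate n (\<phi> x)"
proof -
  have step: "\<phi> (translate 1 x) = translate 1 (\<phi> x)" if "x \<in> X" for x
    using \<phi> that by (simp add: Aut_def shift_eq_translate)
  have pos: "\<phi> (translate (int m) x) = translate (int m) (\<phi> x)" if x: "x \<in> X" for m x
  proof (induction m)
    case (Suc m)
    have "\<phi> (translate (int (Suc m)) x) = \<phi> (translate 1 (translate (int m) x))" by simp
    also have "\<dots> = translate (int (Suc m)) (\<phi> x)"
      unfolding step[OF translate_in[OF x]] Suc by simp
    finally show ?case .
  qed simp
  show ?thesis
  proof (cases n rule: int_cases2)
    case (nonneg m)
    then show ?thesis using pos assms by simp
  next
    case (nonpos m)
    define y where "y = translate (- int m) x"
    have "x = translate (int m) y" by (simp add: y_def)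
    then have "\<phi> x = translate (int m) (\<phi> y)" using pos translate_in[OF assms(2)] y_def by metis
    then show ?thesis by (simp add: nonpos flip: y_def)
  qed
qed

lemma Aut_pow_in: "\<phi> \<in> carrier G \<Longrightarrow> x \<in> X \<Longrightarrow> (\<phi> [^]\<^bsub>G\<^esub> (n::nat)) x \<in> X"
  by simp

lemma Aut_pow_Suc: "\<phi> \<in> carrier G \<Longrightarrow> x \<in> X \<Longrightarrow> (\<phi> [^]\<^bsub>G\<^esub> Suc n) x = \<phi> ((\<phi> [^]\<^bsub>G\<^esub> n) x)"
  by (simp add: G.nat_pow_Suc2 del: G.nat_pow_Suc nat_pow_Suc)

lemma Aut_pow_add:
  "\<phi> \<in> carrier G \<Longrightarrow> x \<in> X \<Longrightarrow>
    (\<phi> [^]\<^bsub>G\<^esub> (m + n)) x = (\<phi> [^]\<^bsub>G\<^esub> m) ((\<phi> [^]\<^bsub>G\<^esub> (n::nat)) x)"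
  by (simp flip: G.nat_pow_mult)

definition has_radius :: "nat \<Rightarrow> ((int \<Rightarrow> 'a) \<Rightarrow> int \<Rightarrow> 'a) \<Rightarrow> bool"
  where "has_radius r \<phi> \<longleftrightarrow>
    (\<forall>x\<in>X. \<forall>y\<in>X. \<forall>a b. agree (a - int r) (b + int r) x y \<longrightarrow> agree a b (\<phi> x) (\<phi> y))"

lemma has_radiusD:
  "has_radius r \<phi> \<Longrightarrow> x \<in> X \<Longrightarrow> y \<in> X \<Longrightarrow> agree (a - int r) (b + int r) x y \<Longrightarrow> agree a b (\<phi> x) (\<phi> y)"
  by (auto simp: has_radius_def)

lemma has_radius_mono: "has_radius r \<phi> \<Longrightarrow> r \<le> s \<Longrightarrow> has_radius s \<phi>"
  unfolding has_radius_def
  by (meson agree_mono diff_left_mono add_left_mono of_nat_mono)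

lemma has_radius_mult:
  assumes "\<phi> \<in> carrier G" "\<psi> \<in> carrier G" "has_radius r \<phi>" "has_radius s \<psi>"
  shows "has_radius (r + s) (\<phi> \<otimes>\<^bsub>G\<^esub> \<psi>)"
  unfolding has_radius_def
proof (intro ballI allI impI)
  fix x y a b assume xy: "x \<in> X" "y \<in> X" and ag: "agree (a - int (r + s)) (b + int (r + s)) x y"
  have "agree (a - int r) (b + int r) (\<psi> x) (\<psi> y)"
    using has_radiusD[OF assms(4) xy, of "a - int r" "b + int r"] ag by (simp add: algebra_simps)
  then show "agree a b ((\<phi> \<otimes>\<^bsub>G\<^esub> \<psi>) x) ((\<phi> \<otimes>\<^bsub>G\<^esub> \<psi>) y)"
    using has_radiusD[OF assms(3)] assms(1,2) xy by simp
qed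

text \<open>
  The theorem of Curtis, Hedlund and Lyndon. By continuity the letter of \<open>\<phi> x\<close> at 0 depends on a
  finite window of \<open>x\<close>, by compactness the size of the window can be chosen independently of
  \<open>x\<close>, and the other letters follow because \<open>\<phi>\<close> commutes with the shift.
\<close>

theorem has_radius_exists:
  assumes \<phi>: "\<phi> \<in> carrier G"
  shows "\<exists>r. has_radius r \<phi>"
proof -
  define U where "U n = {x \<in> X. \<forall>y\<in>X. agree (- int n) (int n + 1) x y \<longrightarrow> \<phi> y 0 = \<phi> x 0}" for n :: nat
  have "\<exists>n. X \<subseteq> U n"
  proof (rule exhaustion_terminates)
    show "U n \<subseteq> X" for n by (auto simp: U_def)
    show "U m \<subseteq> U n" if "m \<le> n" for m n
      using that agree_mono[of "- int n" "int n + 1" _ _ "- int m" "int m + 1"] by (auto simp: U_def)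
    show "\<exists>m::nat. \<forall>x\<in>U n. \<forall>y\<in>X. agree (- int m) (int m + 1) x y \<longrightarrow> y \<in> U n" for n
    proof (intro exI[of _ n] ballI impI)
      fix x y assume x: "x \<in> U n" and y: "y \<in> X" and xy: "agree (- int n) (int n + 1) x y"
      have const: "\<phi> u 0 = \<phi> x 0" if "u \<in> X" "agree (- int n) (int n + 1) x u" for u
        using x that unfolding U_def by blast
      have "\<phi> u 0 = \<phi> y 0" if "u \<in> X" "agree (- int n) (int n + 1) y u" for u
        using const[OF that(1) agree_trans[OF xy that(2)]] const[OF y xy] by (rule trans[OF _ sym])
      then show "y \<in> U n" using y unfolding U_def by blast
    qed
    show "X \<subseteq> (\<Union>n. U n)"
    proof
      fix x assume x: "x \<in> X"
      have "continuous_map T T \<phi>"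
        using \<phi> by (simp add: Aut_def homeomorphic_imp_continuous_map)
      then have "openin T {y \<in> topspace T. \<phi> y \<in> {u \<in> X. \<forall>j\<in>{0}. u j = \<phi> x j}}"
        by (rule openin_continuous_map_preimage) (rule openin_cylinder, simp)
      then have "\<exists>n::nat. \<forall>y\<in>X. agree (- int n) (int n + 1) x y \<longrightarrow>
          y \<in> {y \<in> topspace T. \<phi> y \<in> {u \<in> X. \<forall>j\<in>{0}. u j = \<phi> x j}}"
        by (rule open_contains_cylinder, unfold topspace_T) (use \<phi> x in simp)
      then show "x \<in> (\<Union>n. U n)" using x unfolding U_def by blast
    qed
  qed
  then obtain r where r: "X \<subseteq> U r" ..
  have "has_radius r \<phi>"
    unfolding has_radius_def
  proof (intro ballI allI impI)
    fix x y a b assume xy: "x \<in> X" "y \<in> X" and ag: "agree (a - int r) (b + int r) x y"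
    have "\<phi> x i = \<phi> y i" if "a \<le> i" "i < b" for i
    proof -
      have "agree (- int r) (int r + 1) (translate i x) (translate i y)"
        unfolding agree_translate by (rule agree_mono[OF ag]) (use that in auto)
      then have "\<phi> (translate i y) 0 = \<phi> (translate i x) 0"
        using r translate_in xy unfolding U_def by blast
      then show ?thesis using \<phi> xy by (simp add: Aut_translate)
    qed
    then show "agree a b (\<phi> x) (\<phi> y)" by (simp add: agree_def)
  qed
  then show ?thesis ..
qed

definition shift_aut :: "(int \<Rightarrow> 'a) \<Rightarrow> int \<Rightarrow> 'a"
  where "shift_aut = restrict shift X"

lemma shift_aut_in: "shift_aut \<in> carrier G"
proof -
  have cont: "continuous_map T T (translate n)" for n
  proof -
    have "continuous_map (full_shift A) (full_shift A) (translate n)"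
      unfolding full_shift_def translate_def continuous_map_componentwise_UNIV
      by (intro allI continuous_map_product_projection) simp
    then show ?thesis
      unfolding continuous_map_in_subtopology
      using continuous_map_from_subtopology translate_in by fastforce
  qed
  have hom: "homeomorphic_map T T (translate 1)"
    unfolding homeomorphic_map_maps homeomorphic_maps_def
    by (rule exI[of _ "translate (- 1)"]) (simp add: cont)
  have eq: "shift_aut x = translate 1 x" if "x \<in> X" for x
    using that by (simp add: shift_aut_def shift_eq_translate)
  have "homeomorphic_map T T shift_aut"
    by (rule homeomorphic_map_eq[OF hom]) (simp add: eq)
  moreover have "bij_betw shift_aut X X"
    by (rule bij_betw_byWitness[of _ "translate (- 1)"]) (auto simp: eq translate_in)
  moreover have "shift_aut (shift x) = shift (shift_aut x)" if "x \<in> X" for x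
    using that by (simp add: eq shift_eq_translate translate_in)
  ultimately show ?thesis
    by (simp add: Aut_def Bij_def) (simp add: shift_aut_def)
qed

lemma shift_aut_pow [simp]: "x \<in> X \<Longrightarrow> (shift_aut [^]\<^bsub>G\<^esub> (n::nat)) x = translate (int n) x"
proof (induction n arbitrary: x)
  case (Suc n)
  have "(shift_aut [^]\<^bsub>G\<^esub> n \<otimes>\<^bsub>G\<^esub> shift_aut) x = (shift_aut [^]\<^bsub>G\<^esub> n) (translate 1 x)"
    using Suc.prems shift_aut_in by (simp add: shift_aut_def shift_eq_translate)
  also have "\<dots> = translate (int (Suc n)) x"
    unfolding Suc.IH[OF translate_in[OF Suc.prems]] by (simp add: add.commute)
  finally show ?case by simp
qed simp

lemma shift_aut_pow_central:
  assumes "\<phi> \<in> carrier G"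
  shows "shift_aut [^]\<^bsub>G\<^esub> (n::nat) \<otimes>\<^bsub>G\<^esub> \<phi> = \<phi> \<otimes>\<^bsub>G\<^esub> shift_aut [^]\<^bsub>G\<^esub> n"
  using assms shift_aut_in by (intro Aut_eqI) (simp_all add: Aut_translate)

section \<open>Automorphisms are separated by the image of a rigid word\<close>

text \<open>The word \<open>x\<^sub>0 \<dots> x\<^sub>k\<^sub>-\<^sub>1\<close> is named by a point \<open>x\<close> in which it occurs at the origin.\<close>

definition extends_uniquely :: "nat \<Rightarrow> nat \<Rightarrow> (int \<Rightarrow> 'a) \<Rightarrow> bool"
  where "extends_uniquely k m x \<longleftrightarrow>
    x \<in> X \<and> (\<forall>y\<in>X. agree 0 (int k) y x \<longrightarrow> agree (- int m) (int k + int m) y x)"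

text \<open>
  A point \<open>x\<close> is cut by the occurrences of the word \<open>w\<close> into finitely many kinds of blocks,
  and \<open>\<alpha>\<close> preserves the places of the cuts. Since \<open>w\<close> determines its surroundings up to the
  radius of \<open>\<alpha>\<close>, the image of a block depends on the block alone. So \<open>\<alpha>\<close> permutes
  the finite set of blocks, and some power of \<open>\<alpha>\<close> fixes every block.

  In the proof a block is a window of bounded length between two occurrences \<open>p\<close> and \<open>q\<close>.
\<close>

theorem finite_order_if_preserves_occurrences:
  assumes \<alpha>: "\<alpha> \<in> carrier G" and radius: "has_radius m \<alpha>" and ext: "extends_uniquely k m x0"
    and pres: "\<And>x. x \<in> X \<Longrightarrow> agree 0 (int k) (\<alpha> x) x0 \<longleftrightarrow> agree 0 (int k) x x0"
  shows "\<exists>d::nat>0. \<alpha> [^]\<^bsub>G\<^esub> d = \<one>\<^bsub>G\<^esub>"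
proof -
  define occ where "occ p x \<longleftrightarrow> agree 0 (int k) (translate p x) x0" for p x
  have occ_\<alpha>: "occ p (\<alpha> x) \<longleftrightarrow> occ p x" if "x \<in> X" for p x
    using pres[OF translate_in[OF that], of p] by (simp only: occ_def Aut_translate[OF \<alpha> that])
  have occ_ext: "agree (p - int m) (p + int k + int m) x y"
    if "x \<in> X" "y \<in> X" "occ p x" "occ p y" for p x y
  proof -
    have "agree (- int m) (int k + int m) (translate p x) x0" if "x \<in> X" "occ p x" for x
      using ext that translate_in unfolding extends_uniquely_def occ_def by blast
    then have "agree (- int m) (int k + int m) (translate p x) (translate p y)"
      using that by (meson agree_sym agree_trans)
    then show ?thesis unfolding agree_translate by (simp add: algebra_simps)
  qed
  define E where "E p q x y \<longleftrightarrow> x \<in> X \<and> y \<in> X \<and> occ p x \<and> occ p y \<and> occ q x \<and> occ q y \<and>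
    agree p (q + int k) x y" for p q x y
  have E_step: "E p q (\<alpha> x) (\<alpha> y)" if "E p q x y" for p q x y
  proof -
    have xy: "x \<in> X" "y \<in> X" and o: "occ p x" "occ p y" "occ q x" "occ q y"
      and ag: "agree p (q + int k) x y" using that by (auto simp: E_def)
    have "agree (p - int m) (q + int k + int m) x y"
      unfolding agree_def
    proof (intro allI impI)
      fix i assume i: "p - int m \<le> i" "i < q + int k + int m"
      consider "i < p" | "p \<le> i" "i < q + int k" | "q + int k \<le> i" by linarith
      then show "x i = y i"
      proof cases
        case 1
        then show ?thesis using occ_ext[OF xy o(1,2)] i by (simp add: agree_def)
      next
        case 2
        then show ?thesis using ag by (simp add: agree_def)
      next
        case 3
        then show ?thesis using occ_ext[OF xy o(3,4)] i by (simp add: agree_def)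
      qed
    qed
    then have "agree p (q + int k) (\<alpha> x) (\<alpha> y)" by (rule has_radiusD[OF radius xy])
    then show ?thesis using xy o \<alpha> by (simp add: E_def occ_\<alpha>)
  qed
  have E_pow: "E p q ((\<alpha> [^]\<^bsub>G\<^esub> n) x) ((\<alpha> [^]\<^bsub>G\<^esub> n) y)" if "E p q x y" for p q x y and n :: nat
  proof (induction n)
    case 0
    then show ?case using that by (simp add: E_def)
  next
    case (Suc n)
    have "x \<in> X" "y \<in> X" using that by (simp_all add: E_def)
    then show ?case unfolding Aut_pow_Suc[OF \<alpha> \<open>x \<in> X\<close>] Aut_pow_Suc[OF \<alpha> \<open>y \<in> X\<close>]
      using E_step[OF Suc] by blast
  qed
  have occ_pow: "occ p ((\<alpha> [^]\<^bsub>G\<^esub> n) x) \<longleftrightarrow> occ p x" if "x \<in> X" for p x and n :: nat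
  proof (induction n)
    case (Suc n)
    then show ?case unfolding Aut_pow_Suc[OF \<alpha> that] using occ_\<alpha>[OF Aut_pow_in[OF \<alpha> that]] by blast
  qed (use that in simp)
  have "x0 \<in> X" using ext by (simp add: extends_uniquely_def)
  then obtain N :: nat where N: "\<And>x. x \<in> X \<Longrightarrow> \<exists>p. \<bar>p\<bar> \<le> int N \<and> agree 0 (int k) (translate p x) x0"
    using syndetic by blast
  define w where "w x = map x [- (2 * int N)..2 * int N + int k]" for x :: "int \<Rightarrow> 'a"
  define L where "L = length [- (2 * int N)..2 * int N + int k]"
  define W where "W = {u. set u \<subseteq> A \<and> length u = L}"
  have finW: "finite W" unfolding W_def by (rule finite_lists_length_eq[OF finite_alphabet])
  have wW: "w x \<in> W" if "x \<in> X" for x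
    using in_alphabet[OF that] by (auto simp: w_def W_def L_def)
  define C where "C = card W"
  have fixed: "(\<alpha> [^]\<^bsub>G\<^esub> (fact C :: nat)) x 0 = x 0" if x: "x \<in> X" for x
  proof -
    \<comment> \<open>Two of the first \<open>C + 1\<close> images of \<open>y\<close> have the same block, and the remaining steps to
      \<open>x = \<alpha> ^ C y\<close> carry this coincidence over to \<open>x\<close> and one of its images.\<close>
    define y where "y = (inv\<^bsub>G\<^esub> (\<alpha> [^]\<^bsub>G\<^esub> C)) x"
    have y: "y \<in> X" "(\<alpha> [^]\<^bsub>G\<^esub> C) y = x" using x \<alpha> by (simp_all add: y_def)
    obtain p0 where p0: "\<bar>p0\<bar> \<le> int N" "agree 0 (int k) (translate p0 (translate (- int N) y)) x0"
      using N[OF translate_in[OF y(1)]] by blast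
    obtain q0 where q0: "\<bar>q0\<bar> \<le> int N" "agree 0 (int k) (translate q0 (translate (int N + 1) y)) x0"
      using N[OF translate_in[OF y(1)]] by blast
    define p where "p = p0 - int N"
    define q where "q = q0 + (int N + 1)"
    have occ: "occ p y" "occ q y" using p0(2) q0(2) by (simp_all add: occ_def p_def q_def)
    have pq: "- (2 * int N) \<le> p" "p \<le> 0" "0 < q" "q \<le> 2 * int N + 1"
      using p0(1) q0(1) by (auto simp: p_def q_def)
    have "\<not> inj_on (\<lambda>i. w ((\<alpha> [^]\<^bsub>G\<^esub> i) y)) {..C}"
    proof
      assume inj: "inj_on (\<lambda>i. w ((\<alpha> [^]\<^bsub>G\<^esub> i) y)) {..C}"
      have "(\<lambda>i. w ((\<alpha> [^]\<^bsub>G\<^esub> i) y)) ` {..C} \<subseteq> W"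
        using wW Aut_pow_in[OF \<alpha> y(1)] by blast
      then show False using card_inj_on_le[OF inj _ finW] by (simp add: C_def)
    qed
    then obtain i j where "i \<le> C" "j \<le> C" "i \<noteq> j" "w ((\<alpha> [^]\<^bsub>G\<^esub> i) y) = w ((\<alpha> [^]\<^bsub>G\<^esub> j) y)"
      by (auto simp: inj_on_def)
    then obtain i j where ij: "i < j" "j \<le> C" "w ((\<alpha> [^]\<^bsub>G\<^esub> i) y) = w ((\<alpha> [^]\<^bsub>G\<^esub> j) y)"
      by (metis nat_neq_iff)
    have "agree p (q + int k) ((\<alpha> [^]\<^bsub>G\<^esub> i) y) ((\<alpha> [^]\<^bsub>G\<^esub> j) y)"
      unfolding agree_def
    proof (intro allI impI)
      fix t assume "p \<le> t" "t < q + int k"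
      then have "t \<in> set [- (2 * int N)..2 * int N + int k]" using pq by auto
      then show "(\<alpha> [^]\<^bsub>G\<^esub> i) y t = (\<alpha> [^]\<^bsub>G\<^esub> j) y t"
        using ij(3) unfolding w_def map_eq_conv by blast
    qed
    then have "E p q ((\<alpha> [^]\<^bsub>G\<^esub> i) y) ((\<alpha> [^]\<^bsub>G\<^esub> j) y)"
      using y(1) \<alpha> occ by (simp add: E_def occ_pow)
    then have "E p q ((\<alpha> [^]\<^bsub>G\<^esub> (C - i)) ((\<alpha> [^]\<^bsub>G\<^esub> i) y)) ((\<alpha> [^]\<^bsub>G\<^esub> (C - i)) ((\<alpha> [^]\<^bsub>G\<^esub> j) y))"
      by (rule E_pow)
    moreover define d where "d = j - i"
    have "C - i + i = C" "C - i + j = d + C" using ij by (auto simp: d_def)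
    ultimately have E1: "E p q x ((\<alpha> [^]\<^bsub>G\<^esub> d) x)"
      using Aut_pow_add[OF \<alpha> y(1), of "C - i" i] Aut_pow_add[OF \<alpha> y(1), of "C - i" j]
        Aut_pow_add[OF \<alpha> y(1), of d C] y(2) by simp
    have multiple: "agree p (q + int k) x ((\<alpha> [^]\<^bsub>G\<^esub> (t * d)) x)" for t
    proof (induction t)
      case 0
      then show ?case using x by simp
    next
      case (Suc t)
      have "E p q ((\<alpha> [^]\<^bsub>G\<^esub> (t * d)) x) ((\<alpha> [^]\<^bsub>G\<^esub> (t * d)) ((\<alpha> [^]\<^bsub>G\<^esub> d) x))"
        by (rule E_pow[OF E1])
      then have "E p q ((\<alpha> [^]\<^bsub>G\<^esub> (t * d)) x) ((\<alpha> [^]\<^bsub>G\<^esub> (Suc t * d)) x)"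
        using Aut_pow_add[OF \<alpha> x, of "t * d" d] by (simp add: add.commute)
      then show ?case using Suc agree_trans unfolding E_def by blast
    qed
    have "d dvd fact C"
      using ij by (intro dvd_fact) (auto simp: d_def)
    then obtain t where "fact C = t * d" by (metis dvd_def mult.commute)
    then show ?thesis using multiple[of t] pq by (simp add: agree_def)
  qed
  have "(\<alpha> [^]\<^bsub>G\<^esub> (fact C :: nat)) x = x" if x: "x \<in> X" for x
  proof
    fix i
    have "(\<alpha> [^]\<^bsub>G\<^esub> (fact C :: nat)) (translate i x) 0 = translate i x 0"
      by (rule fixed[OF translate_in[OF x]])
    then show "(\<alpha> [^]\<^bsub>G\<^esub> (fact C :: nat)) x i = x i"
      using Aut_translate[OF _ x, of "\<alpha> [^]\<^bsub>G\<^esub> (fact C :: nat)" i] \<alpha> by simp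
  qed
  then have "\<alpha> [^]\<^bsub>G\<^esub> (fact C :: nat) = \<one>\<^bsub>G\<^esub>"
    using \<alpha> by (intro Aut_eqI) auto
  then show ?thesis using fact_gt_zero by blast
qed

definition has_radius_with_inverse :: "nat \<Rightarrow> ((int \<Rightarrow> 'a) \<Rightarrow> int \<Rightarrow> 'a) \<Rightarrow> bool"
  where "has_radius_with_inverse r \<phi> \<longleftrightarrow> \<phi> \<in> carrier G \<and> has_radius r \<phi> \<and> has_radius r (inv\<^bsub>G\<^esub> \<phi>)"

text \<open>
  If \<open>\<phi>\<close> and \<open>\<psi>\<close> send the word \<open>w\<close> to the same word, then \<open>\<phi>\<inverse> \<psi>\<close> and \<open>\<psi>\<inverse> \<phi>\<close>
  send occurrences of \<open>w\<close> to occurrences of \<open>w\<close>. The margin \<open>2 r\<close> is the radius of \<open>\<phi>\<inverse> \<psi>\<close>: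
  of the letters determined by \<open>w\<close>, a margin \<open>r\<close> is lost under \<open>\<psi>\<close> and another under \<open>\<phi>\<inverse>\<close>.
\<close>

lemma finite_order_if_equal_images:
  assumes \<phi>: "has_radius_with_inverse r \<phi>" and \<psi>: "has_radius_with_inverse r \<psi>" and ext: "extends_uniquely k (2 * r) x0"
    and eq: "agree (- int r) (int k + int r) (\<phi> x0) (\<psi> x0)"
  shows "\<exists>d::nat>0. (inv\<^bsub>G\<^esub> \<phi> \<otimes>\<^bsub>G\<^esub> \<psi>) [^]\<^bsub>G\<^esub> d = \<one>\<^bsub>G\<^esub>"
proof (rule finite_order_if_preserves_occurrences[OF _ _ ext])
  have carr: "\<phi> \<in> carrier G" "\<psi> \<in> carrier G" using \<phi> \<psi> by (simp_all add: has_radius_with_inverse_def)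
  have x0: "x0 \<in> X" using ext by (simp add: extends_uniquely_def)
  show "inv\<^bsub>G\<^esub> \<phi> \<otimes>\<^bsub>G\<^esub> \<psi> \<in> carrier G" using carr by simp
  show "has_radius (2 * r) (inv\<^bsub>G\<^esub> \<phi> \<otimes>\<^bsub>G\<^esub> \<psi>)"
    using has_radius_mult[of "inv\<^bsub>G\<^esub> \<phi>" \<psi> r r] \<phi> \<psi> by (simp add: has_radius_with_inverse_def mult_2)
  have pres: "agree 0 (int k) ((inv\<^bsub>G\<^esub> \<phi>) (\<psi> x)) x0"
    if "has_radius_with_inverse r \<phi>" "has_radius_with_inverse r \<psi>" "agree (- int r) (int k + int r) (\<phi> x0) (\<psi> x0)"
      "x \<in> X" "agree 0 (int k) x x0" for \<phi> \<psi> x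
  proof -
    have carr: "\<phi> \<in> carrier G" "\<psi> \<in> carrier G" using that by (simp_all add: has_radius_with_inverse_def)
    have "agree (- int r - int r) (int k + int r + int r) x x0"
      using ext that(4,5) by (simp add: extends_uniquely_def algebra_simps)
    then have "agree (- int r) (int k + int r) (\<psi> x) (\<psi> x0)"
      using has_radiusD[of r \<psi> x x0] that x0 by (simp add: has_radius_with_inverse_def)
    then have "agree (- int r) (int k + int r) (\<psi> x) (\<phi> x0)"
      using that(3) agree_sym agree_trans by metis
    then have "agree 0 (int k) ((inv\<^bsub>G\<^esub> \<phi>) (\<psi> x)) ((inv\<^bsub>G\<^esub> \<phi>) (\<phi> x0))"
      using has_radiusD[of r "inv\<^bsub>G\<^esub> \<phi>" "\<psi> x" "\<phi> x0" 0 "int k"] that x0 carr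
      by (simp add: has_radius_with_inverse_def)
    then show ?thesis using carr x0 by simp
  qed
  fix x assume x: "x \<in> X"
  show "agree 0 (int k) ((inv\<^bsub>G\<^esub> \<phi> \<otimes>\<^bsub>G\<^esub> \<psi>) x) x0 \<longleftrightarrow> agree 0 (int k) x x0"
  proof
    assume "agree 0 (int k) x x0"
    then show "agree 0 (int k) ((inv\<^bsub>G\<^esub> \<phi> \<otimes>\<^bsub>G\<^esub> \<psi>) x) x0"
      using pres[OF \<phi> \<psi> eq x] carr x by simp
  next
    assume "agree 0 (int k) ((inv\<^bsub>G\<^esub> \<phi> \<otimes>\<^bsub>G\<^esub> \<psi>) x) x0"
    then have "agree 0 (int k) ((inv\<^bsub>G\<^esub> \<psi>) (\<phi> ((inv\<^bsub>G\<^esub> \<phi>) (\<psi> x)))) x0"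
      using pres[OF \<psi> \<phi> agree_sym[OF eq], of "(inv\<^bsub>G\<^esub> \<phi>) (\<psi> x)"] carr x by simp
    then show "agree 0 (int k) x x0" using carr x by simp
  qed
qed

section \<open>Counting words\<close>

definition word_at_0 :: "nat \<Rightarrow> (int \<Rightarrow> 'a) \<Rightarrow> 'a list"
  where "word_at_0 n x = map (\<lambda>i. x (int i)) [0..<n]"

lemma word_at_0_eq_iff: "word_at_0 n x = word_at_0 n y \<longleftrightarrow> agree 0 (int n) x y"
proof
  assume "word_at_0 n x = word_at_0 n y"
  then have *: "x (int i) = y (int i)" if "i < n" for i using that by (simp add: word_at_0_def)
  show "agree 0 (int n) x y"
    unfolding agree_def
  proof (intro allI impI)
    fix i :: int assume "0 \<le> i" "i < int n"
    then show "x i = y i" using *[of "nat i"] by simp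
  qed
qed (simp add: word_at_0_def agree_def)

lemma complexity_eq: "complexity A X n = card (word_at_0 n ` X)"
proof -
  have "{w. length w = n \<and> set w \<subseteq> A \<and> (\<exists>x\<in>X. \<forall>i<n. x (int i) = w ! i)} = word_at_0 n ` X"
  proof
    show "{w. length w = n \<and> set w \<subseteq> A \<and> (\<exists>x\<in>X. \<forall>i<n. x (int i) = w ! i)} \<subseteq> word_at_0 n ` X"
    proof clarify
      fix w x assume "x \<in> X" "\<forall>i<length w. x (int i) = w ! i"
      then show "w \<in> word_at_0 (length w) ` X"
        by (intro image_eqI[of _ _ x] nth_equalityI) (simp_all add: word_at_0_def)
    qed
    show "word_at_0 n ` X \<subseteq> {w. length w = n \<and> set w \<subseteq> A \<and> (\<exists>x\<in>X. \<forall>i<n. x (int i) = w ! i)}"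
      using in_alphabet by (auto simp: word_at_0_def)
  qed
  then show ?thesis by (simp add: complexity_def)
qed

lemma finite_words: "finite (word_at_0 n ` X)"
proof (rule finite_subset)
  show "word_at_0 n ` X \<subseteq> {w. set w \<subseteq> A \<and> length w = n}"
    using in_alphabet by (auto simp: word_at_0_def)
qed (rule finite_lists_length_eq[OF finite_alphabet])

lemma complexity_pos: "complexity A X n > 0"
  using minimal finite_words unfolding complexity_eq card_gt_0_iff
  by (auto simp: minimal_subshift_def)

lemma complexity_mono: "m \<le> n \<Longrightarrow> complexity A X m \<le> complexity A X n"
proof -
  assume "m \<le> n"
  then have "take m (word_at_0 n x) = word_at_0 m x" for x by (simp add: word_at_0_def take_map)
  then have "word_at_0 m ` X = take m ` word_at_0 n ` X" by (simp add: image_image)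
  then show ?thesis unfolding complexity_eq by (simp add: card_image_le finite_words)
qed

text \<open>If every word of length \<open>k\<close> had two extensions, the complexity would double.\<close>

lemma extends_uniquely_exists:
  assumes "complexity A X (k + 2 * m) < 2 * complexity A X k"
  shows "\<exists>x. extends_uniquely k m x"
proof (rule ccontr)
  assume none: "\<nexists>x. extends_uniquely k m x"
  define V where "V = word_at_0 (k + 2 * m) ` X"
  define f where "f v = take k (drop m v)" for v :: "'a list"
  have f: "f (word_at_0 (k + 2 * m) x) = word_at_0 k (translate (int m) x)" for x
    unfolding f_def word_at_0_def
    by (rule nth_equalityI) (auto simp: add.commute)
  have finV: "finite V" by (simp add: V_def finite_words)
  have two: "2 \<le> card {v \<in> V. f v = u}" if u: "u \<in> word_at_0 k ` X" for u
  proof -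
    obtain x where x: "x \<in> X" "u = word_at_0 k x" using u by blast
    obtain y where y: "y \<in> X" "agree 0 (int k) y x" "\<not> agree (- int m) (int k + int m) y x"
      using none x(1) unfolding extends_uniquely_def by blast
    define v where "v x = word_at_0 (k + 2 * m) (translate (- int m) x)" for x :: "int \<Rightarrow> 'a"
    have fv: "f (v z) = word_at_0 k z" for z by (simp add: v_def f)
    have "v x \<noteq> v y"
    proof
      assume "v x = v y"
      then have "agree (- int m) (int k + int m) x y"
        by (simp add: v_def word_at_0_eq_iff agree_translate add.commute)
      then show False using y(3) agree_sym by blast
    qed
    moreover have "{v x, v y} \<subseteq> {v \<in> V. f v = u}"
      using x y fv translate_in by (auto simp: V_def v_def word_at_0_eq_iff intro: agree_sym)
    ultimately show ?thesis
      using card_mono[of "{v \<in> V. f v = u}" "{v x, v y}"] finV by simp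
  qed
  have "2 * card (word_at_0 k ` X) = (\<Sum>u\<in>word_at_0 k ` X. 2)" by simp
  also have "\<dots> \<le> (\<Sum>u\<in>word_at_0 k ` X. card {v \<in> V. f v = u})"
    by (rule sum_mono) (rule two)
  also have "\<dots> = (\<Sum>u\<in>word_at_0 k ` X. \<Sum>v | v \<in> V \<and> f v = u. 1)" by simp
  also have "\<dots> = (\<Sum>v\<in>V. 1)"
    by (rule sum.group[OF finV finite_words]) (use f translate_in in \<open>auto simp: V_def\<close>)
  also have "\<dots> = card V" by simp
  finally show False using assms by (simp add: complexity_eq V_def)
qed

text \<open>
  The window \<open>[-r, k + r)\<close> of the image of a point \<open>x\<^sub>0\<close> in which the rigid word occurs separates
  the elements of \<open>F\<close>.
\<close>

lemma card_le_complexity: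
  assumes radius: "\<And>\<phi>. \<phi> \<in> F \<Longrightarrow> has_radius_with_inverse r \<phi>"
    and torsion: "\<And>\<phi> \<psi> d. \<phi> \<in> F \<Longrightarrow> \<psi> \<in> F \<Longrightarrow> d > 0 \<Longrightarrow>
      (inv\<^bsub>G\<^esub> \<phi> \<otimes>\<^bsub>G\<^esub> \<psi>) [^]\<^bsub>G\<^esub> (d::nat) = \<one>\<^bsub>G\<^esub> \<Longrightarrow> \<phi> = \<psi>"
    and few: "complexity A X (k + 4 * r) < 2 * complexity A X k"
  shows "card F \<le> complexity A X (k + 2 * r)"
proof -
  obtain x0 where x0: "extends_uniquely k (2 * r) x0"
    using extends_uniquely_exists[of k "2 * r"] few by auto
  then have x0X: "x0 \<in> X" by (simp add: extends_uniquely_def)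
  define v where "v \<phi> = word_at_0 (k + 2 * r) (translate (- int r) (\<phi> x0))"
    for \<phi> :: "(int \<Rightarrow> 'a) \<Rightarrow> int \<Rightarrow> 'a"
  have "inj_on v F"
  proof (rule inj_onI)
    fix \<phi> \<psi> assume F: "\<phi> \<in> F" "\<psi> \<in> F" and "v \<phi> = v \<psi>"
    then have "agree (- int r) (int k + int r) (\<phi> x0) (\<psi> x0)"
      by (simp add: v_def word_at_0_eq_iff agree_translate add.commute)
    then show "\<phi> = \<psi>"
      using finite_order_if_equal_images[OF radius radius x0] torsion F by blast
  qed
  moreover have "v ` F \<subseteq> word_at_0 (k + 2 * r) ` X"
    using radius x0X translate_in by (auto simp: v_def has_radius_with_inverse_def)
  ultimately show ?thesis
    unfolding complexity_eq using card_inj_on_le finite_words by blast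
qed

section \<open>Growth of torsion free groups of automorphisms\<close>

lemma has_radius_with_inverse_mono: "has_radius_with_inverse r \<phi> \<Longrightarrow> r \<le> s \<Longrightarrow> has_radius_with_inverse s \<phi>"
  using has_radius_mono by (auto simp: has_radius_with_inverse_def)

lemma has_radius_with_inverse_mult: "has_radius_with_inverse r \<phi> \<Longrightarrow> has_radius_with_inverse s \<psi> \<Longrightarrow> has_radius_with_inverse (r + s) (\<phi> \<otimes>\<^bsub>G\<^esub> \<psi>)"
  using has_radius_mult[of \<phi> \<psi> r s] has_radius_mult[of "inv\<^bsub>G\<^esub> \<psi>" "inv\<^bsub>G\<^esub> \<phi>" s r]
  by (simp add: has_radius_with_inverse_def G.inv_mult_group add.commute)

lemma has_radius_with_inverse_one: "has_radius_with_inverse 0 \<one>\<^bsub>G\<^esub>"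
  by (simp add: has_radius_with_inverse_def has_radius_def)

lemma has_radius_with_inverse_pow: "has_radius_with_inverse r \<phi> \<Longrightarrow> has_radius_with_inverse (n * r) (\<phi> [^]\<^bsub>G\<^esub> (n::nat))"
proof (induction n)
  case (Suc n)
  then show ?case using has_radius_with_inverse_mult[of "n * r" "\<phi> [^]\<^bsub>G\<^esub> n" r \<phi>] by (simp add: add.commute)
qed (use has_radius_with_inverse_one in simp)

lemma has_radius_with_inverse_word_ball:
  assumes S: "\<And>s. s \<in> S \<Longrightarrow> has_radius_with_inverse r s" and g: "g \<in> word_ball G S n"
  shows "has_radius_with_inverse (n * r) g"
proof -
  have "has_radius_with_inverse (length w * r) (word_value G w)" if "set w \<subseteq> S" for w
    using that
  proof (induction w)
    case Nil
    then show ?case using has_radius_with_inverse_one by (simp add: word_value_def)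
  next
    case (Cons a w)
    then show ?case using has_radius_with_inverse_mult[OF S, of a "length w * r" "word_value G w"]
      by (simp add: word_value_def)
  qed
  moreover obtain w where "set w \<subseteq> S" "length w \<le> n" "g = word_value G w"
    using g by (auto simp: word_ball_def)
  ultimately show ?thesis using has_radius_with_inverse_mono[of "length w * r" g "n * r"] by simp
qed

lemma has_radius_with_inverse_exists: "\<phi> \<in> carrier G \<Longrightarrow> \<exists>r. has_radius_with_inverse r \<phi>"
proof -
  assume \<phi>: "\<phi> \<in> carrier G"
  then obtain r s where "has_radius r \<phi>" "has_radius s (inv\<^bsub>G\<^esub> \<phi>)"
    using has_radius_exists by (meson G.inv_closed)
  then have "has_radius_with_inverse (max r s) \<phi>"
    using \<phi> has_radius_mono[of r \<phi> "max r s"] has_radius_mono[of s "inv\<^bsub>G\<^esub> \<phi>" "max r s"]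
    by (simp add: has_radius_with_inverse_def)
  then show ?thesis ..
qed

lemma common_radius:
  assumes "finite S" "S \<subseteq> carrier G"
  shows "\<exists>r>0. \<forall>\<phi>\<in>S. has_radius_with_inverse r \<phi>"
  using assms
proof induction
  case empty
  then show ?case by auto
next
  case (insert \<phi> S)
  then obtain r s where rs: "r > 0" "\<forall>\<psi>\<in>S. has_radius_with_inverse r \<psi>" "has_radius_with_inverse s \<phi>"
    using has_radius_with_inverse_exists by blast
  then have "\<forall>\<psi>\<in>insert \<phi> S. has_radius_with_inverse (max r s) \<psi>"
    using has_radius_with_inverse_mono[of r _ "max r s"] has_radius_with_inverse_mono[of s _ "max r s"] by auto
  moreover have "max r s > 0" using rs(1) by simp
  ultimately show ?case by blast
qed

lemma complexity_eventually_small: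
  assumes "limsup (\<lambda>n. ereal (real (complexity A X n) / real n ^ 3)) = 0" and "\<epsilon> > 0"
  shows "\<exists>N. \<forall>n\<ge>N. real (complexity A X n) \<le> \<epsilon> * real n ^ 3"
proof -
  have "eventually (\<lambda>n. ereal (real (complexity A X n) / real n ^ 3) < ereal \<epsilon>) sequentially"
    using assms by (intro Limsup_lessD) simp
  then have "eventually (\<lambda>n. real (complexity A X n) \<le> \<epsilon> * real n ^ 3) sequentially"
    using eventually_gt_at_top[of 0] by eventually_elim (simp add: divide_less_eq)
  then show ?thesis by (simp add: eventually_sequentially)
qed

text \<open>
  The radius of the elements \<open>g z ^ i\<close> grows linearly with \<open>n\<close>, and at infinitely many scales
  their number is bounded by the number of words of a length that is linear in the radius.
\<close>

lemma subcubic_growth: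
  assumes complexity: "limsup (\<lambda>n. ereal (real (complexity A X n) / real n ^ 3)) = 0"
    and fin: "finite S" and S: "S \<subseteq> carrier G" and z: "z \<in> carrier G"
    and torsion: "\<And>n \<phi> \<psi> d. \<phi> \<in> {g \<otimes>\<^bsub>G\<^esub> z [^]\<^bsub>G\<^esub> i | g (i::nat). g \<in> word_ball G S n \<and> i < n} \<Longrightarrow>
      \<psi> \<in> {g \<otimes>\<^bsub>G\<^esub> z [^]\<^bsub>G\<^esub> i | g (i::nat). g \<in> word_ball G S n \<and> i < n} \<Longrightarrow> d > 0 \<Longrightarrow>
      (inv\<^bsub>G\<^esub> \<phi> \<otimes>\<^bsub>G\<^esub> \<psi>) [^]\<^bsub>G\<^esub> (d::nat) = \<one>\<^bsub>G\<^esub> \<Longrightarrow> \<phi> = \<psi>"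
    and \<epsilon>: "\<epsilon> > 0"
  shows "\<exists>n\<ge>1. real (card {g \<otimes>\<^bsub>G\<^esub> z [^]\<^bsub>G\<^esub> i | g (i::nat). g \<in> word_ball G S n \<and> i < n}) \<le> \<epsilon> * real n ^ 3"
proof -
  obtain R where R: "R > 0" "\<And>s. s \<in> insert z S \<Longrightarrow> has_radius_with_inverse R s"
    using common_radius[of "insert z S"] fin S z by auto
  \<comment> \<open>The elements counted have radius at most \<open>2 R n \<le> r\<close>. The rigid word has length \<open>20 r\<close>
    and the words counted have length \<open>22 r\<close>, which is at most \<open>88 R n\<close>.\<close>
  define \<delta> where "\<delta> = \<epsilon> / real (88 * R) ^ 3"
  have \<delta>: "\<delta> > 0" using \<epsilon> R(1) by (simp add: \<delta>_def)
  obtain N where N: "\<And>n. n \<ge> N \<Longrightarrow> real (complexity A X n) \<le> 1 * real n ^ 3"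
    using complexity_eventually_small[OF complexity, of 1] by auto
  obtain N' where N': "\<And>n. n \<ge> N' \<Longrightarrow> real (complexity A X n) \<le> \<delta> * real n ^ 3"
    using complexity_eventually_small[OF complexity \<delta>] by auto
  have "\<exists>r\<ge>max N' (2 * R). complexity A X (24 * r) < 2 * complexity A X (20 * r)"
    by (rule not_doubling_infinitely_often[of _ N]) (use complexity_mono complexity_pos N in auto)
  then obtain r where r: "r \<ge> N'" "r \<ge> 2 * R" "complexity A X (24 * r) < 2 * complexity A X (20 * r)"
    by auto
  define n where "n = r div (2 * R)"
  define F where "F = {g \<otimes>\<^bsub>G\<^esub> z [^]\<^bsub>G\<^esub> i | g (i::nat). g \<in> word_ball G S n \<and> i < n}"
  have n: "n \<ge> 1" unfolding n_def using r(2) R(1) by (simp add: div_greater_zero_iff Suc_le_eq)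
  have nr: "2 * R * n \<le> r" unfolding n_def by simp
  have "r < 2 * R * (n + 1)"
    unfolding n_def using dividend_less_times_div[of "2 * R" r] R(1) by simp
  also have "\<dots> \<le> 4 * R * n" using n by (simp add: algebra_simps)
  finally have rn: "r \<le> 4 * R * n" by simp
  have "has_radius_with_inverse r \<phi>" if \<phi>: "\<phi> \<in> F" for \<phi>
  proof -
    obtain g i where gi: "\<phi> = g \<otimes>\<^bsub>G\<^esub> z [^]\<^bsub>G\<^esub> (i::nat)" "g \<in> word_ball G S n" "i < n"
      using \<phi> by (auto simp: F_def)
    have "has_radius_with_inverse (n * R + i * R) \<phi>"
      unfolding gi(1) using has_radius_with_inverse_word_ball[OF _ gi(2), of R] has_radius_with_inverse_pow[of R z i] R(2)
      by (intro has_radius_with_inverse_mult) auto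
    moreover have "n * R + i * R \<le> r"
    proof -
      have "i * R \<le> n * R" using gi(3) by (intro mult_le_mono1) simp
      moreover have "n * R + n * R \<le> r" using nr by (simp add: algebra_simps)
      ultimately show ?thesis by linarith
    qed
    ultimately show ?thesis by (rule has_radius_with_inverse_mono)
  qed
  moreover have "\<phi> = \<psi>" if "\<phi> \<in> F" "\<psi> \<in> F" "d > 0"
      "(inv\<^bsub>G\<^esub> \<phi> \<otimes>\<^bsub>G\<^esub> \<psi>) [^]\<^bsub>G\<^esub> (d::nat) = \<one>\<^bsub>G\<^esub>" for \<phi> \<psi> d
    using torsion[of \<phi> n \<psi> d] that by (simp add: F_def)
  moreover have "complexity A X (20 * r + 4 * r) < 2 * complexity A X (20 * r)"
    using r(3) by (simp add: algebra_simps)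
  ultimately have "card F \<le> complexity A X (20 * r + 2 * r)"
    by (rule card_le_complexity)
  then have "real (card F) \<le> real (complexity A X (22 * r))" by simp
  also have "\<dots> \<le> \<delta> * real (22 * r) ^ 3" by (rule N') (use r(1) in simp)
  also have "\<dots> \<le> \<delta> * real (88 * R * n) ^ 3"
    using \<delta> rn by (intro mult_left_mono power_mono of_nat_mono) auto
  also have "\<dots> = \<epsilon> * real n ^ 3" using R(1) by (simp add: \<delta>_def power_mult_distrib)
  finally show ?thesis using n unfolding F_def by blast
qed

text \<open>A point of period \<open>j\<close> is determined by \<open>j\<close> consecutive letters, so \<open>X\<close> is finite.\<close>

lemma finite_Aut_if_shift_periodic:
  assumes j: "j > 0" "shift_aut [^]\<^bsub>G\<^esub> (j::nat) = \<one>\<^bsub>G\<^esub>"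
  shows "finite (carrier G)"
proof -
  have per: "translate (int j) x = x" if "x \<in> X" for x
    using shift_aut_pow[OF that, of j] that by (simp only: j(2) Aut_one)
  have "inj_on (word_at_0 j) X"
  proof (rule inj_onI)
    fix x y assume xy: "x \<in> X" "y \<in> X" "word_at_0 j x = word_at_0 j y"
    have mult: "translate (int (t * j)) x = x" if x: "x \<in> X" for x and t :: nat
    proof (induction t)
      case (Suc t)
      have "translate (int (Suc t * j)) x = translate (int j) (translate (int (t * j)) x)"
        by (simp only: translate_translate mult_Suc of_nat_add)
      then show ?case by (simp only: Suc per[OF x])
    qed simp
    have red: "x i = x (i mod int j)" if x: "x \<in> X" for x i
    proof -
      define y where "y = translate (i mod int j) x"
      define t where "t = nat \<bar>i div int j\<bar>"
      consider "i = i mod int j + int (t * j)" | "i mod int j = i + int (t * j)"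
        unfolding t_def using mod_mult_div_eq[of i "int j"]
        by (cases "i div int j \<ge> 0") (simp_all add: algebra_simps)
      then show ?thesis
      proof cases
        case 1
        then show ?thesis using fun_cong[OF mult[OF x, of t], of "i mod int j"] by simp
      next
        case 2
        then show ?thesis using fun_cong[OF mult[OF x, of t], of i] by simp
      qed
    qed
    show "x = y"
    proof
      fix i
      have "x (i mod int j) = y (i mod int j)"
        using xy(3) j(1) by (simp add: word_at_0_eq_iff agree_def)
      then show "x i = y i" using red xy by metis
    qed
  qed
  then have "finite X" using finite_words finite_imageD by blast
  then have "finite (X \<rightarrow>\<^sub>E X)" by (simp add: finite_PiE)
  moreover have "carrier G \<subseteq> X \<rightarrow>\<^sub>E X"
    unfolding PiE_def using Bij_imp_extensional[OF Aut_Bij] Bij_imp_funcset[OF Aut_Bij] by blast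
  ultimately show ?thesis by (rule rev_finite_subset)
qed

text \<open>
  Adjoining \<open>\<sigma>\<close> itself to \<open>H\<close> can create torsion: if \<open>h ^ m = \<sigma> ^ (j m)\<close> for some \<open>h \<in> H\<close> other than
  \<open>\<sigma> ^ j\<close>, then \<open>h \<sigma> ^ (- j)\<close> has finite order. But then \<open>\<sigma> ^ k \<in> H\<close> for some \<open>k > 0\<close>, and adjoining
  \<open>\<sigma> ^ k\<close> does not enlarge \<open>H\<close>.
\<close>

lemma torsion_free_extension_by_shift_power:
  assumes H: "subgroup H G" and tf: "torsion_free_group (G\<lparr>carrier := H\<rparr>)"
  shows "\<exists>k>0. \<forall>h\<in>H. \<forall>l::int. \<forall>d>0. (h \<otimes>\<^bsub>G\<^esub> (shift_aut [^]\<^bsub>G\<^esub> (k::nat)) [^]\<^bsub>G\<^esub> l) [^]\<^bsub>G\<^esub> (d::nat) = \<one>\<^bsub>G\<^esub> \<longrightarrow>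
    h \<otimes>\<^bsub>G\<^esub> (shift_aut [^]\<^bsub>G\<^esub> k) [^]\<^bsub>G\<^esub> l = \<one>\<^bsub>G\<^esub>"
proof -
  have tf: "h = \<one>\<^bsub>G\<^esub>" if "h \<in> H" "d > 0" "h [^]\<^bsub>G\<^esub> (d::nat) = \<one>\<^bsub>G\<^esub>" for h d
    using tf that unfolding torsion_free_group_def by (simp add: G.nat_pow_consistent[symmetric])
  show ?thesis
  proof (cases "\<exists>k>0. shift_aut [^]\<^bsub>G\<^esub> (k::nat) \<in> H")
    case True
    then obtain k :: nat where k: "k > 0" "shift_aut [^]\<^bsub>G\<^esub> k \<in> H" by blast
    have "h \<otimes>\<^bsub>G\<^esub> (shift_aut [^]\<^bsub>G\<^esub> k) [^]\<^bsub>G\<^esub> l \<in> H" if "h \<in> H" for h and l :: int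
      using that subgroup.m_closed[OF H] G.subgroup_int_pow_closed[OF H k(2)] by blast
    then show ?thesis using k(1) tf by blast
  next
    case False
    define s where "s = shift_aut"
    have s: "s \<in> carrier G" by (simp add: s_def shift_aut_in)
    have no: "s [^]\<^bsub>G\<^esub> (k::nat) \<notin> H" if "k > 0" for k using False that unfolding s_def by blast
    have "h \<otimes>\<^bsub>G\<^esub> s [^]\<^bsub>G\<^esub> l = \<one>\<^bsub>G\<^esub>"
      if h: "h \<in> H" and d: "d > 0" "(h \<otimes>\<^bsub>G\<^esub> s [^]\<^bsub>G\<^esub> l) [^]\<^bsub>G\<^esub> (d::nat) = \<one>\<^bsub>G\<^esub>" for h d and l :: int
    proof -
      have hG: "h \<in> carrier G" using h H subgroup.mem_carrier by metis
      have "s [^]\<^bsub>G\<^esub> l \<otimes>\<^bsub>G\<^esub> h = h \<otimes>\<^bsub>G\<^esub> s [^]\<^bsub>G\<^esub> l"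
        using G.int_pow_commute[OF s hG] shift_aut_pow_central[OF hG, of 1] s by (simp add: s_def)
      then have "(h \<otimes>\<^bsub>G\<^esub> s [^]\<^bsub>G\<^esub> l) [^]\<^bsub>G\<^esub> int d = h [^]\<^bsub>G\<^esub> int d \<otimes>\<^bsub>G\<^esub> (s [^]\<^bsub>G\<^esub> l) [^]\<^bsub>G\<^esub> int d"
        using hG s by (intro G.int_pow_mult_distrib) auto
      then have eq: "h [^]\<^bsub>G\<^esub> int d \<otimes>\<^bsub>G\<^esub> s [^]\<^bsub>G\<^esub> (l * int d) = \<one>\<^bsub>G\<^esub>"
        using d(2) unfolding G.int_pow_pow[OF s] by (simp only: int_pow_int)
      have "l = 0"
      proof (rule ccontr)
        assume l: "l \<noteq> 0"
        have "inv\<^bsub>G\<^esub> (s [^]\<^bsub>G\<^esub> (l * int d)) = h [^]\<^bsub>G\<^esub> int d"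
          using G.inv_equality[OF eq] hG s by simp
        then have "inv\<^bsub>G\<^esub> (s [^]\<^bsub>G\<^esub> (l * int d)) \<in> H"
          using G.subgroup_int_pow_closed[OF H h] by simp
        then have "s [^]\<^bsub>G\<^esub> (l * int d) \<in> H"
          using subgroup.m_inv_closed[OF H] G.inv_inv[OF G.int_pow_closed[OF s]] by metis
        then have "s [^]\<^bsub>G\<^esub> \<bar>l * int d\<bar> \<in> H"
          using subgroup.m_inv_closed[OF H] s by (auto simp: abs_if G.int_pow_neg)
        then have "s [^]\<^bsub>G\<^esub> nat \<bar>l * int d\<bar> \<in> H"
          by (metis abs_ge_zero int_pow_int nat_0_le)
        moreover have "nat \<bar>l * int d\<bar> > 0" using l d(1) by simp
        ultimately show False using no by blast
      qed
      then have "h = \<one>\<^bsub>G\<^esub>" using d tf[OF h d(1)] hG by simp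
      then show ?thesis using \<open>l = 0\<close> by simp
    qed
    then show ?thesis using s by (intro exI[of _ 1]) (auto simp: s_def)
  qed
qed

text \<open>
  The group theoretic criterion needs a central element of infinite order. A power of the shift
  is one unless the shift has finite order, and then the automorphism group is finite.
\<close>

theorem virtually_abelian_if_subcubic_complexity:
  assumes complexity: "limsup (\<lambda>n. ereal (real (complexity A X n) / real n ^ 3)) = 0"
    and H: "subgroup H G" and fg: "finitely_generated_group (G\<lparr>carrier := H\<rparr>)"
    and tf: "torsion_free_group (G\<lparr>carrier := H\<rparr>)"
  shows "virtually_abelian_group (G\<lparr>carrier := H\<rparr>)"
proof (cases "\<exists>j>0. shift_aut [^]\<^bsub>G\<^esub> (j::nat) = \<one>\<^bsub>G\<^esub>")
  case True
  then have "finite H"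
    using finite_Aut_if_shift_periodic subgroup.subset[OF H] finite_subset by blast
  then show ?thesis
    by (intro G.virtually_abelian_if_finitely_many_cosets[OF H G.triv_subgroup]) auto
next
  case False
  obtain S0 where S0: "finite S0" "S0 \<subseteq> H" "generate G S0 = H"
    using fg G.generate_consistent[OF _ H] unfolding finitely_generated_group_def by auto
  define S where "S = S0 \<union> m_inv G ` S0"
  have S0G: "S0 \<subseteq> carrier G" using S0(2) subgroup.subset[OF H] by blast
  have fin: "finite S" and S: "S \<subseteq> carrier G" using S0(1) S0G by (auto simp: S_def)
  have H_eq: "H = (\<Union>n. word_ball G S n)"
    using G.generate_eq_word_balls[OF S0G] S0(3) by (simp add: S_def)
  obtain k :: nat where k: "k > 0" and tors: "\<And>h (l::int) d. h \<in> H \<Longrightarrow> d > 0 \<Longrightarrow>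
      (h \<otimes>\<^bsub>G\<^esub> (shift_aut [^]\<^bsub>G\<^esub> k) [^]\<^bsub>G\<^esub> l) [^]\<^bsub>G\<^esub> (d::nat) = \<one>\<^bsub>G\<^esub> \<Longrightarrow>
      h \<otimes>\<^bsub>G\<^esub> (shift_aut [^]\<^bsub>G\<^esub> k) [^]\<^bsub>G\<^esub> l = \<one>\<^bsub>G\<^esub>"
    using torsion_free_extension_by_shift_power[OF H tf] by blast
  define z where "z = shift_aut [^]\<^bsub>G\<^esub> k"
  have z: "z \<in> carrier G" using shift_aut_in by (simp add: z_def)
  have central: "z \<otimes>\<^bsub>G\<^esub> g = g \<otimes>\<^bsub>G\<^esub> z" if "g \<in> carrier G" for g
    unfolding z_def by (rule shift_aut_pow_central[OF that])
  show ?thesis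
  proof (rule G.virtually_abelian_if_subcubic_growth[OF H fin S H_eq z central])
    show "z [^]\<^bsub>G\<^esub> (j::nat) \<noteq> \<one>\<^bsub>G\<^esub>" if "j > 0" for j
    proof -
      have "k * j > 0" using k that by simp
      then show ?thesis using False unfolding z_def G.nat_pow_pow[OF shift_aut_in] by blast
    qed
    fix \<epsilon> :: real assume \<epsilon>: "\<epsilon> > 0"
    show "\<exists>n\<ge>1. real (card {g \<otimes>\<^bsub>G\<^esub> z [^]\<^bsub>G\<^esub> i | g (i::nat). g \<in> word_ball G S n \<and> i < n}) \<le> \<epsilon> * real n ^ 3"
    proof (rule subcubic_growth[OF complexity fin S z _ \<epsilon>])
      fix n \<phi> \<psi> and d :: nat
      assume \<phi>: "\<phi> \<in> {g \<otimes>\<^bsub>G\<^esub> z [^]\<^bsub>G\<^esub> i | g (i::nat). g \<in> word_ball G S n \<and> i < n}"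
        and \<psi>: "\<psi> \<in> {g \<otimes>\<^bsub>G\<^esub> z [^]\<^bsub>G\<^esub> i | g (i::nat). g \<in> word_ball G S n \<and> i < n}"
        and d: "d > 0" "(inv\<^bsub>G\<^esub> \<phi> \<otimes>\<^bsub>G\<^esub> \<psi>) [^]\<^bsub>G\<^esub> d = \<one>\<^bsub>G\<^esub>"
      obtain g i where g: "g \<in> H" "\<phi> = g \<otimes>\<^bsub>G\<^esub> z [^]\<^bsub>G\<^esub> int i"
        using \<phi> H_eq by (auto simp: int_pow_int)
      obtain h j where h: "h \<in> H" "\<psi> = h \<otimes>\<^bsub>G\<^esub> z [^]\<^bsub>G\<^esub> int j"
        using \<psi> H_eq by (auto simp: int_pow_int)
      have carr: "g \<in> carrier G" "h \<in> carrier G" using g h H subgroup.mem_carrier by metis+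
      define u where "u = inv\<^bsub>G\<^esub> g \<otimes>\<^bsub>G\<^esub> h"
      have u: "u \<in> H" "u \<in> carrier G"
        using g h carr subgroup.m_closed[OF H] subgroup.m_inv_closed[OF H] by (simp_all add: u_def)
      have "inv\<^bsub>G\<^esub> \<phi> \<otimes>\<^bsub>G\<^esub> \<psi> = z [^]\<^bsub>G\<^esub> (- int i) \<otimes>\<^bsub>G\<^esub> u \<otimes>\<^bsub>G\<^esub> z [^]\<^bsub>G\<^esub> int j"
        using g h carr z by (simp add: u_def G.inv_mult_group G.int_pow_neg G.m_assoc)
      also have "\<dots> = u \<otimes>\<^bsub>G\<^esub> (z [^]\<^bsub>G\<^esub> (- int i) \<otimes>\<^bsub>G\<^esub> z [^]\<^bsub>G\<^esub> int j)"
        unfolding G.int_pow_commute[OF z u(2) central[OF u(2)]] using u z by (simp add: G.m_assoc)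
      also have "\<dots> = u \<otimes>\<^bsub>G\<^esub> z [^]\<^bsub>G\<^esub> (- int i + int j)"
        by (simp only: G.int_pow_mult[OF z])
      finally have "inv\<^bsub>G\<^esub> \<phi> \<otimes>\<^bsub>G\<^esub> \<psi> = u \<otimes>\<^bsub>G\<^esub> z [^]\<^bsub>G\<^esub> (- int i + int j)" .
      then have "inv\<^bsub>G\<^esub> \<phi> \<otimes>\<^bsub>G\<^esub> \<psi> = \<one>\<^bsub>G\<^esub>"
        using tors[OF u(1) d(1), of "- int i + int j"] d(2) by (simp add: z_def)
      moreover have "\<phi> \<in> carrier G" "\<psi> \<in> carrier G" using g h carr z by simp_all
      then have "\<phi> \<otimes>\<^bsub>G\<^esub> (inv\<^bsub>G\<^esub> \<phi> \<otimes>\<^bsub>G\<^esub> \<psi>) = \<psi>" "\<phi> \<otimes>\<^bsub>G\<^esub> \<one>\<^bsub>G\<^esub> = \<phi>"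
        by (simp_all flip: G.m_assoc)
      ultimately show "\<phi> = \<psi>" by metis
    qed
  qed
qed

end

theorem corollary1p3:
  fixes A :: "'a set" and X :: "(int \<Rightarrow> 'a) set" and H :: "((int \<Rightarrow> 'a) \<Rightarrow> int \<Rightarrow> 'a) set"
  assumes "minimal_subshift A X"
    and "limsup (\<lambda>n. ereal (real (complexity A X n) / real n ^ 3)) = 0"
    and "subgroup H (Aut A X)"
    and "finitely_generated_group ((Aut A X)\<lparr>carrier := H\<rparr>)"
    and "torsion_free_group ((Aut A X)\<lparr>carrier := H\<rparr>)"
  shows "virtually_abelian_group ((Aut A X)\<lparr>carrier := H\<rparr>)"
proof -
  interpret minimal_shift A X using assms(1) by unfold_locales
  show ?thesis using assms(2-5) by (rule virtually_abelian_if_subcubic_complexity)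
qed

end
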